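(* Let $\mathbb H,\mathbb V,\mathbb M_1,\mathbb M_2$, $\mathsf A_\star$, $\mathsf B$, $\mathsf A$, $\mathsf G$ and $C_{\mathrm{lift}}$ satisfy all the hypotheses of the abstract framework described in the context, and let $\mathbb M:=\mathbb M_1\times\mathbb M_2$. If $F\in W^1(\mathbb H)$ and $\Xi:=(\xi,\chi)\in W^2(\mathbb M)$, then the problem $$\dot U(t)=\mathsf A_\star U(t)+\mathsf G\xi(t)+F(t)\quad t\ge0,\qquad \mathsf BU(t)=\chi(t)\quad t\ge0,\qquad U(0)=0,$$ has a unique solution $U\in\mathcal C^1([0,\infty);\mathbb H)\cap\mathcal C([0,\infty);\mathbb V)$, and for all $t\ge0$ $$\|U(t)\|_{\mathbb H}\le C_{\mathrm{lift}}\Big(\int_0^t\|\Xi(\tau)\|_{\mathbb M}\,\mathrm d\tau+2\int_0^t\|\dot\Xi(\tau)\|_{\mathbb M}\,\mathrm d\tau\Big)+\int_0^t\|F(\tau)\|_{\mathbb H}\,\mathrm d\tau,$$ $$\|\dot U(t)\|_{\mathbb H}\le C_{\mathrm{lift}}\Big(\int_0^t\|\dot\Xi(\tau)\|_{\mathbb M}\,\mathrm d\tau+2\int_0^t\|\ddot\Xi(\tau)\|_{\mathbb M}\,\mathrm d\tau\Big)+\int_0^t\|\dot F(\tau)\|_{\mathbb H}\,\mathrm d\tau.$$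
   Context: Abstract framework. $\mathbb H,\mathbb V,\mathbb M_1,\mathbb M_2$ are (real) Hilbert spaces, with $\mathbb V$ continuously embedded into $\mathbb H$. $\mathsf A_\star:\mathbb V\to\mathbb H$ and $\mathsf G:\mathbb M_1\to\mathbb H$ are bounded linear operators, and $\mathsf B:\mathbb V\to\mathbb M_2$ is a bounded linear surjective operator. The following hypotheses hold: (i) There are constants $C_1^\star,C_2^\star>0$ with $C_1^\star\|U\|_{\mathbb V}\le\|U\|_{\mathbb H}+\|\mathsf A_\star U\|_{\mathbb H}\le C_2^\star\|U\|_{\mathbb V}$ for all $U\in\mathbb V$. (ii) Let $\mathsf A:=\mathsf A_\star|_{D(\mathsf A)}:D(\mathsf A)\subset\mathbb H\to\mathbb H$ with $D(\mathsf A):=\mathrm{Ker}\,\mathsf B$. Then $(\mathsf AU,U)_{\mathbb H}=0$ for all $U\in D(\mathsf A)$, and both $\mathsf I+\mathsf A$ and $\mathsf I-\mathsf A$ map $D(\mathsf A)$ onto $\mathbb H$ (that is, $\pm\mathsf A$ are maximal dissipative). (iii) For every $\Xi=(\xi,\chi)\in\mathbb M:=\mathbb M_1\times\mathbb M_2$ there exists a unique $U\in\mathbb V$ with $U=\mathsf A_\star U+\mathsf G\xi$ and $\mathsf BU=\chi$, and $\|U\|_{\mathbb H}+\|U\|_{\mathbb V}\le C_{\mathrm{lift}}\|\Xi\|_{\mathbb M}$, with $C_{\mathrm{lift}}$ independent of $\Xi$. For a Hilbert space $X$ and $k\ge1$, $W^k(X):=\{f\in\mathcal C^{k-1}([0,\infty);X):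 f^{(k)}\in L^1((0,\infty);X),\ f^{(\ell)}(0)=0,\ 0\le\ell\le k-1\}$. *)

theory Defs
  imports "HOL-Analysis.Analysis"
begin

section \<open>Functions on the half line with values in a Hilbert space\<close>

text \<open>At the endpoint 0 the derivative is one-sided.\<close>

definition dt :: "(real \<Rightarrow> 'a::real_normed_vector) \<Rightarrow> real \<Rightarrow> 'a" where
  "dt f = (\<lambda>t. vector_derivative f (at t within {0..}))"

definition C_space :: "nat \<Rightarrow> (real \<Rightarrow> 'a::real_normed_vector) set" where
  "C_space k = {f. (\<forall>l<k. \<forall>t\<ge>0. ((dt ^^ l) f) differentiable (at t within {0..})) \<and>
                   continuous_on {0..} ((dt ^^ k) f)}"

text \<open>Bochner's space L1 over the open half line. The library's Bochner integral is restricted to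
  second countable types, whereas the Hilbert spaces here need not be separable, so strong
  measurability (almost everywhere limit of simple functions) is spelled out.\<close>

definition L1_space :: "(real \<Rightarrow> 'a::real_normed_vector) set" where
  "L1_space = {g. (\<exists>s. (\<forall>n::nat. simple_function (lebesgue_on {0<..}) (s n)) \<and>
                       (AE t in lebesgue_on {0<..}. (\<lambda>n. s n t) \<longlonglongrightarrow> g t)) \<and>
                  (\<integral>\<^sup>+ t. ennreal (norm (g t)) \<partial>lebesgue_on {0<..}) < \<infinity>}"

text \<open>The space of the functions f of class C^(k-1) on the closed half line, with vanishing derivatives at 0
  up to the order k - 1, whose derivative of order k is in L1; meant for k at least 1.
  The derivative of order k is the weak one: the derivative of order k - 1 exists classically and
  is the primitive of an L1 function. By Lebesgue's differentiation theorem that L1 function is, up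
  to a null set, the almost everywhere pointwise derivative, so \<^term>\<open>(dt ^^ k) f\<close> is a
  representative of it (its values on the exceptional null set are immaterial). For a function in
  \<^const>\<open>L1_space\<close> the gauge integral expressed by \<^const>\<open>has_integral\<close> exists and is
  the Bochner integral.\<close>

definition W_space :: "nat \<Rightarrow> (real \<Rightarrow> 'a::real_normed_vector) set" where
  "W_space k = {f. f \<in> C_space (k - 1) \<and>
                   (AE t in lebesgue_on {0<..}. ((dt ^^ (k - 1)) f) differentiable (at t within {0..})) \<and>
                   (dt ^^ k) f \<in> L1_space \<and>
                   (\<forall>t\<ge>0. ((dt ^^ k) f has_integral ((dt ^^ (k - 1)) f t - (dt ^^ (k - 1)) f 0)) {0..t}) \<and>
                   (\<forall>l\<le>k - 1. (dt ^^ l) f 0 = 0)}"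


section \<open>The abstract framework\<close>

text \<open>The space V is a type of its own, and \<open>\<iota>\<close> is its embedding into H. The operator A is the
  restriction of \<open>Astar\<close> to the kernel of B, regarded as an unbounded operator in H.\<close>

definition dom_A :: "('v \<Rightarrow> 'h) \<Rightarrow> ('v \<Rightarrow> 'm2::zero) \<Rightarrow> 'h set" where
  "dom_A \<iota> B = \<iota> ` {U. B U = 0}"

definition op_A :: "('v \<Rightarrow> 'h) \<Rightarrow> ('v \<Rightarrow> 'h) \<Rightarrow> 'h \<Rightarrow> 'h" where
  "op_A \<iota> Astar u = Astar (inv \<iota> u)"

locale abstract_framework =
  fixes \<iota> :: "'v::{real_inner, banach} \<Rightarrow> 'h::{real_inner, banach}"
    and Astar :: "'v \<Rightarrow> 'h"
    and G :: "'m1::{real_inner, banach} \<Rightarrow> 'h"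
    and B :: "'v \<Rightarrow> 'm2::{real_inner, banach}"
    and C_lift :: real
  assumes embedding: "bounded_linear \<iota>" "inj \<iota>"
    and bounded_linear_Astar: "bounded_linear Astar"
    and bounded_linear_G: "bounded_linear G"
    and bounded_linear_B: "bounded_linear B"
    and surj_B: "surj B"
    and graph_norm: "\<exists>C\<^sub>1>0. \<exists>C\<^sub>2>0. \<forall>U. C\<^sub>1 * norm U \<le> norm (\<iota> U) + norm (Astar U) \<and>
                                      norm (\<iota> U) + norm (Astar U) \<le> C\<^sub>2 * norm U"
    and skew: "\<forall>u\<in>dom_A \<iota> B. inner (op_A \<iota> Astar u) u = 0"
    and onto_plus: "(\<lambda>u. u + op_A \<iota> Astar u) ` dom_A \<iota> B = UNIV"
    and onto_minus: "(\<lambda>u. u - op_A \<iota> Astar u) ` dom_A \<iota> B = UNIV"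
    and lift_unique: "\<forall>\<xi> chi. \<exists>!U. \<iota> U = Astar U + G \<xi> \<and> B U = chi"
    and lift_bound: "\<forall>\<xi> chi U. \<iota> U = Astar U + G \<xi> \<and> B U = chi \<longrightarrow>
                        norm (\<iota> U) + norm U \<le> C_lift * norm (\<xi>, chi)"

definition is_solution ::
  "('v::real_normed_vector \<Rightarrow> 'h::real_normed_vector) \<Rightarrow> ('v \<Rightarrow> 'h) \<Rightarrow> ('m1 \<Rightarrow> 'h) \<Rightarrow> ('v \<Rightarrow> 'm2) \<Rightarrow>
   (real \<Rightarrow> 'm1) \<Rightarrow> (real \<Rightarrow> 'm2) \<Rightarrow> (real \<Rightarrow> 'h) \<Rightarrow> (real \<Rightarrow> 'v) \<Rightarrow> bool" where
  "is_solution \<iota> Astar G B \<xi> chi F U \<longleftrightarrow>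
     (\<lambda>t. \<iota> (U t)) \<in> C_space 1 \<and> U \<in> C_space 0 \<and>
     (\<forall>t\<ge>0. dt (\<lambda>s. \<iota> (U s)) t = Astar (U t) + G (\<xi> t) + F t) \<and>
     (\<forall>t\<ge>0. B (U t) = chi t) \<and>
     U 0 = 0"

end

(* With the lifting operator L, which solves the stationary problem of hypothesis (iii), the solution
   is U = L Xi + v, where v takes values in the kernel of B and solves v' = A v + f with
   f = F + L Xi - (L Xi)' and f(0) = 0. The latter problem is solved by Yosida approximation: z_n is the
   solution for the bounded operator A (1 - A/n)^(-1), and skew-symmetry makes the derivatives z_n'
   uniformly Cauchy. All bounds on derivatives come from the energy estimate for the increments
   z(t + h) - z(t), so that the derivative of f enters only through a scalar bound P(t) - P(s) on the
   increments of f; this avoids Bochner integrals in non-separable spaces. *)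

theory Submission
  imports Defs
begin

section \<open>Energy estimates and limits on the half line\<close>

text \<open>The obstacle is that \<open>f\<close> has only an integrable derivative: no bound on the
  Yosida operators at z_n' is at hand, so z_n' and z_k' cannot be compared directly. They are
  therefore smoothed by a fixed resolvent \<open>Jop (1 / Suc m)\<close>. At smoothed vectors all
  Yosida operators are bounded in terms of m alone, and the squared difference of the smoothed
  derivatives is at most a constant depending on m times 1/(n+1) + 1/(k+1). The smoothing error of
  z_n' is small uniformly in n: 1 - \<open>Jop\<close> commutes with the Yosida operators, so the
  error belongs to an approximate problem whose forcing is the smoothing error of \<open>f\<close>,
  and this is controlled by dominated convergence together with the density of the domain. Hence m
  is chosen before n and k. The condition f(0) = 0 makes z_n'(0) = 0, so that P alone bounds the
  derivatives. The factor 2 in the final bounds arises because the lift enters twice, once directly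
  in U and once through \<open>f\<close>.\<close>

lemma has_vector_derivative_half_line_imp_continuous_on:
  assumes "\<And>t. 0 \<le> t \<Longrightarrow> (z has_vector_derivative z' t) (at t within {0..})"
  shows "continuous_on {0..} z"
  using assms by (auto simp: continuous_on_eq_continuous_within
      intro: has_vector_derivative_continuous)

lemma increment_le_of_derivative_le:
  fixes \<phi> \<psi> :: "real \<Rightarrow> real"
  assumes \<phi>: "\<And>t. 0 \<le> t \<Longrightarrow> (\<phi> has_real_derivative \<phi>' t) (at t within {0..})"
    and \<psi>: "\<And>t. 0 \<le> t \<Longrightarrow> (\<psi> has_real_derivative \<psi>' t) (at t within {0..})"
    and le: "\<And>t. 0 \<le> t \<Longrightarrow> \<phi>' t \<le> \<psi>' t"
    and "0 \<le> t"
  shows "\<phi> t - \<phi> 0 \<le> \<psi> t - \<psi> 0"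
proof -
  have "\<phi> t - \<psi> t \<le> \<phi> 0 - \<psi> 0"
  proof (rule DERIV_nonpos_imp_decreasing_open[OF \<open>0 \<le> t\<close>])
    fix x assume "0 < x" "x < t"
    then have "((\<lambda>s. \<phi> s - \<psi> s) has_real_derivative \<phi>' x - \<psi>' x) (at x within {0..})"
      by (intro DERIV_diff \<phi> \<psi>) auto
    then have "((\<lambda>s. \<phi> s - \<psi> s) has_real_derivative \<phi>' x - \<psi>' x) (at x)"
      using \<open>0 < x\<close> by (simp add: at_within_interior[of x "{0..}"])
    then show "\<exists>y. ((\<lambda>s. \<phi> s - \<psi> s) has_real_derivative y) (at x) \<and> y \<le> 0"
      using le[of x] \<open>0 < x\<close> by (intro exI[of _ "\<phi>' x - \<psi>' x"]) auto
  next
    have "continuous_on {0..} (\<lambda>s. \<phi> s - \<psi> s)"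
      using \<phi> \<psi> by (intro continuous_on_diff)
        (auto simp: continuous_on_eq_continuous_within intro: DERIV_continuous)
    then show "continuous_on {0..t} (\<lambda>s. \<phi> s - \<psi> s)"
      by (rule continuous_on_subset) auto
  qed
  then show ?thesis by simp
qed

lemma has_real_derivative_norm_square:
  fixes z :: "real \<Rightarrow> 'a::real_inner"
  assumes "(z has_vector_derivative z') (at t within S)"
  shows "((\<lambda>s. inner (z s) (z s)) has_real_derivative 2 * inner z' (z t)) (at t within S)"
proof -
  have "((\<lambda>s. inner (z s) (z s)) has_derivative
      (\<lambda>h. inner (z t) (h *\<^sub>R z') + inner (h *\<^sub>R z') (z t))) (at t within S)"
    using assms unfolding has_vector_derivative_def by (intro has_derivative_inner)
  then show ?thesis
    by (simp add: has_field_derivative_def inner_commute algebra_simps mult_commute_abs)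
qed

text \<open>Formally the derivative of \<open>norm (z t)\<close> is
  \<open>inner (z' t) (z t) / norm (z t)\<close>, hence at most \<open>p t\<close>. Being free of
  any operator, the estimate serves solutions, their time increments and differences of two
  solutions alike.\<close>

lemma energy_estimate:
  fixes z :: "real \<Rightarrow> 'a::real_inner"
  assumes z: "\<And>t. 0 \<le> t \<Longrightarrow> (z has_vector_derivative z' t) (at t within {0..})"
    and q: "\<And>t. 0 \<le> t \<Longrightarrow> (q has_real_derivative p t) (at t within {0..})"
    and le: "\<And>t. 0 \<le> t \<Longrightarrow> inner (z' t) (z t) \<le> p t * norm (z t)"
    and p: "\<And>t. 0 \<le> t \<Longrightarrow> 0 \<le> p t"
    and "0 \<le> t"
  shows "norm (z t) \<le> norm (z 0) + (q t - q 0)"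
proof (rule field_le_epsilon)
  fix e :: real assume e: "0 < e"
  \<comment> \<open>The norm is regularised, since it is not differentiable at 0.\<close>
  define \<phi> where "\<phi> s = sqrt (inner (z s) (z s) + e\<^sup>2)" for s
  have pos: "0 < inner (z s) (z s) + e\<^sup>2" for s
    using e by (simp add: add_nonneg_pos)
  have norm_le: "norm (z s) \<le> \<phi> s" for s
    by (simp add: \<phi>_def norm_eq_sqrt_inner)
  have \<phi>_pos: "0 < \<phi> s" for s
    using pos by (simp add: \<phi>_def)
  have "\<phi> t - \<phi> 0 \<le> q t - q 0"
  proof (rule increment_le_of_derivative_le[OF _ q _ \<open>0 \<le> t\<close>])
    fix s :: real assume s: "0 \<le> s"
    show "(\<phi> has_real_derivative inner (z' s) (z s) / \<phi> s) (at s within {0..})"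
    proof -
      have "((\<lambda>r. inner (z r) (z r) + e\<^sup>2) has_real_derivative 2 * inner (z' s) (z s) + 0)
          (at s within {0..})"
        by (intro DERIV_add has_real_derivative_norm_square z s DERIV_const)
      from DERIV_chain2[OF DERIV_real_sqrt[OF pos] this] show ?thesis
        unfolding \<phi>_def by (simp add: divide_simps)
    qed
    \<comment> \<open>Replacing the norm by the larger regularised norm is allowed because
      \<open>p\<close> is nonnegative.\<close>
    have "inner (z' s) (z s) \<le> p s * \<phi> s"
      using le[OF s] mult_left_mono[OF norm_le p[OF s]] by (rule order_trans)
    then show "inner (z' s) (z s) / \<phi> s \<le> p s"
      using \<phi>_pos by (simp add: divide_simps)
  qed
  moreover have "\<phi> 0 \<le> norm (z 0) + e"
    unfolding \<phi>_def power2_norm_eq_inner[symmetric] using e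
    by (intro real_le_lsqrt) (auto simp: power2_eq_square algebra_simps)
  ultimately show "norm (z t) \<le> norm (z 0) + (q t - q 0) + e"
    using norm_le[of t] by linarith
qed

text \<open>Divide by \<open>h\<close> and let \<open>h\<close> decrease to 0. Right difference
  quotients determine the derivative even at the endpoint 0.\<close>

lemma norm_derivative_le_of_increments:
  fixes z :: "real \<Rightarrow> 'a::real_normed_vector"
  assumes z: "(z has_vector_derivative z') (at t within {0..})"
    and q: "(q has_real_derivative p) (at t within {0..})"
    and le: "\<And>h. 0 < h \<Longrightarrow> norm (z (t + h) - z t) \<le> q (t + h) - q t"
    and "0 \<le> t"
  shows "norm z' \<le> p"
proof -
  have sub: "{t<..} \<subseteq> {0..}" using \<open>0 \<le> t\<close> by auto
  have "((\<lambda>y. (z y - z t) /\<^sub>R (y - t) - z') \<longlongrightarrow> 0) (at_right t)"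
  proof (rule Lim_transform_eventually)
    show "((\<lambda>y. (z y - z t - (y - t) *\<^sub>R z') /\<^sub>R norm (y - t)) \<longlongrightarrow> 0) (at_right t)"
      using has_vector_derivative_within_subset[OF z sub]
      by (simp add: has_vector_derivative_def has_derivative_def Lim_ident_at)
    show "\<forall>\<^sub>F y in at_right t. (z y - z t - (y - t) *\<^sub>R z') /\<^sub>R norm (y - t)
        = (z y - z t) /\<^sub>R (y - t) - z'"
      unfolding eventually_at_filter
      by (rule always_eventually) (auto simp: scaleR_diff_right)
  qed
  then have 1: "((\<lambda>y. norm ((z y - z t) /\<^sub>R (y - t))) \<longlongrightarrow> norm z') (at_right t)"
    by (intro tendsto_norm) (simp add: LIM_zero_iff)
  have 2: "((\<lambda>y. (q y - q t) / (y - t)) \<longlongrightarrow> p) (at_right t)"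
    using has_field_derivative_subset[OF q sub] by (simp add: has_field_derivative_iff)
  have "\<forall>\<^sub>F y in at_right t. norm ((z y - z t) /\<^sub>R (y - t)) \<le> (q y - q t) / (y - t)"
    unfolding eventually_at_filter
  proof (rule always_eventually, intro allI impI)
    fix y assume "y \<noteq> t" "y \<in> {t<..}"
    then show "norm ((z y - z t) /\<^sub>R (y - t)) \<le> (q y - q t) / (y - t)"
      using le[of "y - t"] by (simp add: divide_simps)
  qed
  from tendsto_le[OF _ 2 1 this] show ?thesis by simp
qed

lemma has_vector_derivative_shift_half_line:
  fixes q :: "real \<Rightarrow> 'a::real_normed_vector"
  assumes "\<And>t. 0 \<le> t \<Longrightarrow> (q has_vector_derivative p t) (at t within {0..})"
    and "0 \<le> h" "0 \<le> t"
  shows "((\<lambda>s. q (s + h)) has_vector_derivative p (t + h)) (at t within {0..})"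
proof -
  have "((q \<circ> (\<lambda>s. s + h)) has_vector_derivative 1 *\<^sub>R p (t + h)) (at t within {0..})"
  proof (rule vector_diff_chain_within)
    show "((\<lambda>s. s + h) has_vector_derivative 1) (at t within {0..})"
      by (auto intro!: derivative_eq_intros)
    show "(q has_vector_derivative p (t + h)) (at (t + h) within (\<lambda>s. s + h) ` {0..})"
      by (rule has_vector_derivative_within_subset[OF assms(1)]) (use assms in auto)
  qed
  then show ?thesis by (simp add: o_def)
qed

lemma integral_has_vector_derivative_half_line:
  fixes f :: "real \<Rightarrow> 'a::banach"
  assumes "continuous_on {0..} f" "0 \<le> t"
  shows "((\<lambda>s. integral {0..s} f) has_vector_derivative f t) (at t within {0..})"
proof -
  have "((\<lambda>s. integral {0..s} f) has_vector_derivative f t) (at t within {0..t + 1})"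
    by (rule integral_has_vector_derivative)
      (use assms in \<open>auto intro: continuous_on_subset\<close>)
  moreover have "at t within {0..t + 1} = at t within {0..}"
    by (rule at_within_nhd[of t "{..<t+1}"]) auto
  ultimately show ?thesis by simp
qed

lemma integral_has_real_derivative_half_line:
  fixes f :: "real \<Rightarrow> real"
  assumes "continuous_on {0..} f" "0 \<le> t"
  shows "((\<lambda>s. integral {0..s} f) has_real_derivative f t) (at t within {0..})"
  using integral_has_vector_derivative_half_line[OF assms]
  by (simp add: has_real_derivative_iff_has_vector_derivative)

text \<open>Here \<open>z' - f\<close> stands for a linear dissipative operator applied to
  \<open>z\<close>; \<open>diss\<close> and \<open>mono\<close> express dissipativity at a value and
  at a difference of values. The increment of \<open>z\<close> over a time step \<open>h\<close> has
  the increment of \<open>f\<close> as forcing, so \<open>energy_estimate\<close> applies to it with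
  majorant \<open>P (s + h) - P s\<close>, and division by \<open>h\<close> gives the claim.\<close>

lemma derivative_estimate:
  fixes z :: "real \<Rightarrow> 'a::real_inner"
  assumes z: "\<And>t. 0 \<le> t \<Longrightarrow> (z has_vector_derivative z' t) (at t within {0..})"
    and z0: "z 0 = 0"
    and diss: "\<And>t. 0 \<le> t \<Longrightarrow> inner (z' t - f t) (z t) \<le> 0"
    and mono: "\<And>s t. 0 \<le> s \<Longrightarrow> 0 \<le> t \<Longrightarrow>
      inner ((z' s - f s) - (z' t - f t)) (z s - z t) \<le> 0"
    and f0: "f 0 = 0"
    and incr: "\<And>s t. 0 \<le> s \<Longrightarrow> s \<le> t \<Longrightarrow> norm (f t - f s) \<le> P t - P s"
    and P: "continuous_on {0..} P" "P 0 = 0"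
    and "0 \<le> t"
  shows "norm (z' t) \<le> P t"
proof -
  define Q where "Q s = integral {0..s} P" for s
  have Q: "(Q has_real_derivative P s) (at s within {0..})" if "0 \<le> s" for s
    unfolding Q_def using integral_has_real_derivative_half_line[OF P(1) that] .
  have inner_le: "inner a b \<le> p * norm b" if "inner (a - c) b \<le> 0" "norm c \<le> p" for a b c :: 'a and p
  proof -
    have "inner a b \<le> inner c b" using that(1) by (simp add: inner_diff_left)
    also have "\<dots> \<le> norm c * norm b" by (rule norm_cauchy_schwarz)
    also have "\<dots> \<le> p * norm b" using that(2) by (rule mult_right_mono) simp
    finally show ?thesis .
  qed
  have f_le: "norm (f s) \<le> P s" if "0 \<le> s" for s
    using incr[of 0 s] that f0 P(2) by simp
  show ?thesis
  proof (rule norm_derivative_le_of_increments[OF z Q])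
    fix h :: real assume h: "0 < h"
    \<comment> \<open>The increment starts from \<open>z h\<close>. This bound on it cancels the
      term \<open>Q (0 + h) - Q 0\<close> of the next estimate; it rests on
      \<open>norm (f s) \<le> P s\<close>, hence on \<open>f 0 = 0\<close>.\<close>
    have start: "norm (z h) \<le> norm (z 0) + (Q h - Q 0)"
    proof (rule energy_estimate[OF z Q])
      show "inner (z' s) (z s) \<le> P s * norm (z s)" if "0 \<le> s" for s
        by (rule inner_le[OF diss f_le]) (use that in auto)
      show "0 \<le> P s" if "0 \<le> s" for s
        using f_le[OF that] norm_ge_zero order_trans by blast
    qed (use h in auto)
    have "norm (z (t + h) - z t) \<le> norm (z (0 + h) - z 0) + ((Q (t + h) - Q t) - (Q (0 + h) - Q 0))"
    proof (rule energy_estimate[where z = "\<lambda>s. z (s + h) - z s" and z' = "\<lambda>s. z' (s + h) - z' s"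
          and q = "\<lambda>s. Q (s + h) - Q s" and p = "\<lambda>s. P (s + h) - P s"])
      fix s :: real assume s: "0 \<le> s"
      show "((\<lambda>s. z (s + h) - z s) has_vector_derivative z' (s + h) - z' s) (at s within {0..})"
        using s h by (intro has_vector_derivative_diff has_vector_derivative_shift_half_line z) auto
      have "((\<lambda>s. Q (s + h)) has_vector_derivative P (s + h)) (at s within {0..})"
        using s h Q by (intro has_vector_derivative_shift_half_line)
          (auto simp: has_real_derivative_iff_has_vector_derivative)
      then show "((\<lambda>s. Q (s + h) - Q s) has_real_derivative P (s + h) - P s) (at s within {0..})"
        using Q[OF s] by (intro DERIV_diff)
          (auto simp: has_real_derivative_iff_has_vector_derivative)
      have d: "norm (f (s + h) - f s) \<le> P (s + h) - P s"
        using incr[of s "s + h"] s h by auto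
      show "inner (z' (s + h) - z' s) (z (s + h) - z s) \<le> (P (s + h) - P s) * norm (z (s + h) - z s)"
        by (rule inner_le[OF _ d]) (use mono[of "s + h" s] s h in \<open>simp add: algebra_simps\<close>)
      show "0 \<le> P (s + h) - P s"
        using d norm_ge_zero order_trans by blast
    qed (use \<open>0 \<le> t\<close> in auto)
    then show "norm (z (t + h) - z t) \<le> Q (t + h) - Q t"
      using start z0 by simp
  qed (use \<open>0 \<le> t\<close> in auto)
qed

lemma continuous_on_half_lineI:
  fixes f :: "real \<Rightarrow> 'a::topological_space"
  assumes "\<And>T. continuous_on {0..T} f"
  shows "continuous_on {0..} f"
  unfolding continuous_on_eq_continuous_within
proof
  fix t :: real assume t: "t \<in> {0..}"
  have "continuous (at t within {0..t + 1}) f"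
    using assms[of "t + 1"] t by (auto simp: continuous_on_eq_continuous_within)
  moreover have "at t within {0..t + 1} = at t within {0..}"
    by (rule at_within_nhd[of t "{..<t+1}"]) auto
  ultimately show "continuous (at t within {0..}) f"
    by simp
qed

text \<open>The limit is obtained as a primitive of the continuous \<open>w\<close>, so its
  differentiability on the half line, endpoint included, comes for free.\<close>

lemma uniform_limit_antiderivative:
  fixes z :: "nat \<Rightarrow> real \<Rightarrow> 'a::banach"
  assumes z: "\<And>n t. 0 \<le> t \<Longrightarrow> (z n has_vector_derivative y n t) (at t within {0..})"
    and z0: "\<And>n. z n 0 = 0"
    and y: "\<And>n. continuous_on {0..} (y n)"
    and conv: "\<And>T. uniformly_convergent_on {0..T} y"
  obtains w where "continuous_on {0..} w" "\<And>t. 0 \<le> t \<Longrightarrow> (\<lambda>n. y n t) \<longlonglongrightarrow> w t"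
    "\<And>t. 0 \<le> t \<Longrightarrow> (\<lambda>n. z n t) \<longlonglongrightarrow> integral {0..t} w"
proof
  define w where "w t = lim (\<lambda>n. y n t)" for t
  have lim: "uniform_limit {0..T} y w sequentially" for T
    using conv unfolding w_def uniformly_convergent_uniform_limit_iff .
  have cont: "continuous_on {0..T} (y n)" for T n
    using y by (rule continuous_on_subset) auto
  have w_cont: "continuous_on {0..T} w" for T
    by (rule uniform_limit_theorem[OF _ lim]) (auto simp: cont)
  show "continuous_on {0..} w"
    using w_cont by (rule continuous_on_half_lineI)
  show "(\<lambda>n. y n t) \<longlonglongrightarrow> w t" if "0 \<le> t" for t
    using tendsto_uniform_limitI[OF lim[of t]] that by auto
  show "(\<lambda>n. z n t) \<longlonglongrightarrow> integral {0..t} w" if "0 \<le> t" for t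
  proof -
    obtain I J where IJ: "\<And>n. (y n has_integral I n) {0..t}" "(w has_integral J) {0..t}" "I \<longlonglongrightarrow> J"
      by (rule uniform_limit_integral[OF lim cont]) auto
    have "(y n has_integral (z n t - z n 0)) {0..t}" for n
      by (rule fundamental_theorem_of_calculus[OF that])
        (auto intro: has_vector_derivative_within_subset[OF z])
    then have "I = (\<lambda>n. z n t)"
      using has_integral_unique[OF IJ(1)] z0 by fastforce
    then show ?thesis
      using IJ(2,3) by (simp add: integral_unique)
  qed
qed

section \<open>The Cauchy problem for a bounded operator\<close>

lemma bounded_linear_cauchy_problem:
  fixes \<Lambda> :: "'a::banach \<Rightarrow> 'a"
  assumes \<Lambda>: "bounded_linear \<Lambda>" and f: "continuous_on {0..} f"
  obtains z where "z 0 = 0"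
    "\<And>t. 0 \<le> t \<Longrightarrow> (z has_vector_derivative \<Lambda> (z t) + f t) (at t within {0..})"
proof -
  interpret \<Lambda>: bounded_linear \<Lambda> by fact
  \<comment> \<open>Picard iterates started from 0. Note the index: \<open>y n\<close> is the
    derivative of \<open>S (Suc n)\<close>, not of \<open>S n\<close>.\<close>
  define S where "S n = ((\<lambda>u t. integral {0..t} (\<lambda>s. \<Lambda> (u s) + f s)) ^^ n) (\<lambda>t. 0)" for n
  define y where "y n t = \<Lambda> (S n t) + f t" for n t
  have S_0: "S 0 t = 0" and S_Suc: "S (Suc n) t = integral {0..t} (y n)" for n t
    by (simp_all add: S_def y_def [abs_def])
  have S_cont: "continuous_on {0..} (S n)" for n
  proof (induction n)
    case 0
    show ?case by (simp add: S_def)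
  next
    case (Suc n)
    have "continuous_on {0..} (y n)"
      unfolding y_def using Suc f by (intro continuous_intros \<Lambda>.continuous_on)
    then show ?case
      unfolding S_Suc
      by (rule has_vector_derivative_half_line_imp_continuous_on
          [OF integral_has_vector_derivative_half_line])
  qed
  have y_cont: "continuous_on {0..} (y n)" for n
    unfolding y_def using S_cont f by (intro continuous_intros \<Lambda>.continuous_on)
  have y_int: "y n integrable_on {0..t}" for n t
    by (intro integrable_continuous_real continuous_on_subset[OF y_cont]) auto
  obtain K where K: "0 < K" "\<And>x. norm (\<Lambda> x) \<le> norm x * K"
    using \<Lambda>.pos_bounded by blast
  have S_conv: "uniformly_convergent_on {0..T} S" for T
  proof -
    have "compact (S 1 ` {0..T})"
      by (intro compact_continuous_image continuous_on_subset[OF S_cont]) auto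
    then obtain M where M: "\<And>t. t \<in> {0..T} \<Longrightarrow> norm (S 1 t) \<le> M" and "0 \<le> M"
      by (metis bounded_pos compact_imp_bounded imageI less_imp_le)
    \<comment> \<open>The weight \<open>exp (2 * K * t)\<close> absorbs the Lipschitz constant
      \<open>K\<close>: integrating \<open>K * exp (2 * K * s)\<close> produces a factor 1/2, so the
      iteration contracts on intervals of any length.\<close>
    have bound: "norm (S (Suc n) t - S n t) \<le> M * (1/2)^n * exp (2 * K * t)" if "t \<in> {0..T}" for n t
      using that
    proof (induction n arbitrary: t)
      case 0
      have "M * 1 \<le> M * exp (2 * K * t)"
        using 0 K \<open>0 \<le> M\<close> by (intro mult_left_mono) auto
      then show ?case
        using M[OF 0] by (simp add: S_0)
    next
      case (Suc n)
      have "((\<lambda>s. M * (1/2)^n * exp (2 * K * s) * K) has_integral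
          (M * (1/2)^(Suc n) * exp (2 * K * t) - M * (1/2)^(Suc n) * exp (2 * K * 0))) {0..t}"
        using Suc.prems
        by (intro fundamental_theorem_of_calculus)
          (auto intro!: derivative_eq_intros
            simp: has_real_derivative_iff_has_vector_derivative[symmetric])
      note * = this
      have "S (Suc (Suc n)) t - S (Suc n) t = integral {0..t} (\<lambda>s. y (Suc n) s - y n s)"
        unfolding S_Suc by (rule integral_diff[symmetric]) (rule y_int)+
      also have "norm \<dots> \<le> integral {0..t} (\<lambda>s. M * (1/2)^n * exp (2 * K * s) * K)"
      proof (rule integral_norm_bound_integral)
        fix s assume s: "s \<in> {0..t}"
        have "norm (y (Suc n) s - y n s) \<le> norm (S (Suc n) s - S n s) * K"
          using K(2)[of "S (Suc n) s - S n s"] by (simp add: y_def \<Lambda>.diff)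
        also have "\<dots> \<le> M * (1/2)^n * exp (2 * K * s) * K"
          using s Suc.prems K(1) by (intro mult_right_mono Suc.IH) auto
        finally show "norm (y (Suc n) s - y n s) \<le> M * (1/2)^n * exp (2 * K * s) * K" .
      qed (use * in \<open>auto intro: integrable_diff y_int\<close>)
      also have "\<dots> \<le> M * (1/2)^(Suc n) * exp (2 * K * t)"
        using integral_unique[OF *] \<open>0 \<le> M\<close> by simp
      finally show ?case .
    qed
    have "uniformly_convergent_on {0..T} (\<lambda>n t. \<Sum>i<n. S (Suc i) t - S i t)"
    proof (rule uniformly_convergentI[OF Weierstrass_m_test])
      fix n t assume t: "t \<in> {0..T}"
      have "M * (1/2)^n * exp (2 * K * t) \<le> M * (1/2)^n * exp (2 * K * T)"
        using t K \<open>0 \<le> M\<close> by (intro mult_left_mono) auto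
      then show "norm (S (Suc n) t - S n t) \<le> M * (1/2)^n * exp (2 * K * T)"
        using bound[OF t, of n] by linarith
    next
      show "summable (\<lambda>n. M * (1/2)^n * exp (2 * K * T))"
        by (intro summable_mult summable_mult2 summable_geometric) auto
    qed
    moreover have "(\<lambda>n t. \<Sum>i<n. S (Suc i) t - S i t) = S"
    proof (intro ext)
      show "(\<Sum>i<n. S (Suc i) t - S i t) = S n t" for n t
        using sum_lessThan_telescope[of "\<lambda>i. S i t" n] by (simp add: S_0)
    qed
    ultimately show ?thesis by simp
  qed
  have y_conv: "uniformly_convergent_on {0..T} y" for T
  proof -
    obtain l where "uniform_limit {0..T} (\<lambda>n t. \<Lambda> (S n t)) l sequentially"
      using \<Lambda>.uniformly_convergent_on[OF S_conv[of T]] unfolding uniformly_convergent_on_def by blast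
    moreover have "uniform_limit {0..T} (\<lambda>n. f) f sequentially"
      by (rule uniform_limit_const)
    ultimately have "uniform_limit {0..T} (\<lambda>n t. \<Lambda> (S n t) + f t) (\<lambda>t. l t + f t) sequentially"
      by (rule uniform_limit_add)
    then show ?thesis
      unfolding y_def[abs_def] by (rule uniformly_convergentI)
  qed
  obtain w where w: "continuous_on {0..} w" "\<And>t. 0 \<le> t \<Longrightarrow> (\<lambda>n. y n t) \<longlonglongrightarrow> w t"
    "\<And>t. 0 \<le> t \<Longrightarrow> (\<lambda>n. S (Suc n) t) \<longlonglongrightarrow> integral {0..t} w"
    by (rule uniform_limit_antiderivative[where z = "\<lambda>n. S (Suc n)" and y = y])
      (auto simp: S_Suc [abs_def] intro!: integral_has_vector_derivative_half_line y_cont y_conv)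
  have "\<Lambda> (integral {0..t} w) + f t = w t" if "0 \<le> t" for t
  proof (rule LIMSEQ_unique[OF _ w(2)[OF that]])
    have "(\<lambda>n. S n t) \<longlonglongrightarrow> integral {0..t} w"
      using w(3)[OF that] by (rule LIMSEQ_imp_Suc)
    then show "(\<lambda>n. y n t) \<longlonglongrightarrow> \<Lambda> (integral {0..t} w) + f t"
      unfolding y_def by (intro tendsto_add \<Lambda>.tendsto tendsto_const)
  qed
  then show thesis
    using integral_has_vector_derivative_half_line[OF w(1)]
    by (intro that[of "\<lambda>t. integral {0..t} w"]) auto
qed

section \<open>Strongly measurable integrable functions\<close>

text \<open>A real-valued \<open>\<phi>\<close> turns the approximating simple functions into real
  simple functions, and its continuity preserves the almost everywhere limit. From here on scalar
  measure theory suffices.\<close>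

lemma borel_measurable_comp_L1_space:
  fixes g :: "real \<Rightarrow> 'a::real_normed_vector" and \<phi> :: "'a \<Rightarrow> real"
  assumes g: "g \<in> L1_space" and \<phi>: "continuous_on UNIV \<phi>"
  shows "(\<lambda>t. \<phi> (g t)) \<in> borel_measurable (lebesgue_on {0<..})"
proof -
  obtain s where s: "\<And>n::nat. simple_function (lebesgue_on {0<..}) (s n)"
    and ae: "AE t in lebesgue_on {0<..}. (\<lambda>n. s n t) \<longlonglongrightarrow> g t"
    using g by (auto simp: L1_space_def)
  obtain N where N: "{t \<in> space (lebesgue_on {0<..}). \<not> (\<lambda>n. s n t) \<longlonglongrightarrow> g t} \<subseteq> N"
    "emeasure (lebesgue_on {0<..}) N = 0" "N \<in> sets (lebesgue_on {0<..})"
    using ae by (rule AE_E)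
  have neg: "negligible N"
    unfolding negligible_iff_null_sets
    using null_setsI[OF N(2,3)] null_sets_restrict_space[of "{0<..} :: real set" lebesgue N] by simp
  have "(\<lambda>t. \<phi> (g t)) measurable_on {0<..}"
  proof (rule measurable_on_limit[OF _ neg])
    show "(\<lambda>t. \<phi> (s n t)) measurable_on {0<..}" for n
    proof -
      have "(\<lambda>t. \<phi> (s n t)) \<in> borel_measurable (lebesgue_on {0<..})"
        by (rule borel_measurable_simple_function[OF simple_function_compose1[OF s]])
      then show ?thesis
        by (subst measurable_on_UNIV[symmetric], intro lebesgue_measurable_imp_measurable_on
            borel_measurable_if_I) simp_all
    qed
    show "(\<lambda>n. \<phi> (s n t)) \<longlonglongrightarrow> \<phi> (g t)" if "t \<in> {0<..} - N" for t
    proof (rule continuous_on_tendsto_compose[OF \<phi>])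
      show "(\<lambda>n. s n t) \<longlonglongrightarrow> g t"
        using N(1) that by auto
    qed auto
  qed
  then show ?thesis
    by (rule measurable_on_imp_borel_measurable_lebesgue) simp
qed

lemma integrable_on_half_open_imp:
  fixes f :: "real \<Rightarrow> real"
  assumes "f integrable_on {0<..}"
  shows "f integrable_on {0..t}"
proof -
  have "f integrable_on {0..}"
  proof (rule integrable_spike_set[OF assms])
    have *: "{x \<in> {0<..} - {0..}. f x \<noteq> 0} = {}" by auto
    show "negligible {x \<in> {0<..} - {0..}. f x \<noteq> 0}"
      unfolding * by simp
    show "negligible {x \<in> {0..} - {0<..}. f x \<noteq> 0}"
      by (rule negligible_subset[of "{0}"]) auto
  qed
  then show ?thesis
    by (rule integrable_on_subinterval) auto
qed

lemma norm_integrable_on_L1_space: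
  fixes g :: "real \<Rightarrow> 'a::real_normed_vector"
  assumes g: "g \<in> L1_space"
  shows "(\<lambda>t. norm (g t)) integrable_on {0<..}"
proof (rule integrable_on_lebesgue_on)
  show "integrable (lebesgue_on {0<..}) (\<lambda>t. norm (g t))"
  proof (rule integrableI_nonneg)
    show "(\<lambda>t. norm (g t)) \<in> borel_measurable (lebesgue_on {0<..})"
      by (intro borel_measurable_comp_L1_space g continuous_intros)
    show "(\<integral>\<^sup>+ t. ennreal (norm (g t)) \<partial>lebesgue_on {0<..}) < \<infinity>"
      using g by (simp add: L1_space_def)
  qed simp
qed simp

text \<open>Applied with \<open>\<phi>\<close> the norm of x, of K x, or of the smoothing error of
  either; this makes the scalar majorants of all increments integrable.\<close>

lemma comp_integrable_on_L1_space:
  fixes g :: "real \<Rightarrow> 'a::real_normed_vector" and \<phi> :: "'a \<Rightarrow> real"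
  assumes g: "g \<in> L1_space" and \<phi>: "continuous_on UNIV \<phi>"
    and le: "\<And>x. \<bar>\<phi> x\<bar> \<le> c * norm x"
  shows "(\<lambda>t. \<phi> (g t)) integrable_on {0..t}"
proof -
  have "(\<lambda>t. \<phi> (g t)) absolutely_integrable_on {0<..}"
  proof (rule measurable_bounded_by_integrable_imp_absolutely_integrable)
    show "(\<lambda>t. \<phi> (g t)) \<in> borel_measurable (lebesgue_on {0<..})"
      by (rule borel_measurable_comp_L1_space[OF g \<phi>])
    show "(\<lambda>t. c * norm (g t)) integrable_on {0<..}"
      using norm_integrable_on_L1_space[OF g] by (rule integrable_on_mult_right)
  qed (use le in auto)
  then show ?thesis
    by (intro integrable_on_half_open_imp) (auto simp: absolutely_integrable_on_def)
qed

lemma continuous_on_indefinite_integral_half_line: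
  fixes p :: "real \<Rightarrow> 'a::banach"
  assumes "\<And>t. p integrable_on {0..t}"
  shows "continuous_on {0..} (\<lambda>t. integral {0..t} p)"
  by (intro continuous_on_half_lineI indefinite_integral_continuous_1 assms)

text \<open>Supplies the increment bounds in the form that \<open>derivative_estimate\<close> asks
  for, as differences of one real primitive.\<close>

lemma norm_increment_le_integral:
  fixes g f :: "real \<Rightarrow> 'a::banach" and p :: "real \<Rightarrow> real"
  assumes g: "\<And>t. 0 \<le> t \<Longrightarrow> (g has_integral (f t - f 0)) {0..t}"
    and p: "\<And>t. p integrable_on {0..t}"
    and le: "\<And>s. 0 \<le> s \<Longrightarrow> norm (g s) \<le> p s"
    and st: "0 \<le> s" "s \<le> t"
  shows "norm (f t - f s) \<le> integral {0..t} p - integral {0..s} p"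
proof -
  have g_int: "g integrable_on {0..t}" and "f t - f 0 = integral {0..t} g" "f s - f 0 = integral {0..s} g"
    using g[of t] g[of s] st by (auto simp: integral_unique)
  moreover have "integral {0..s} g + integral {s..t} g = integral {0..t} g"
    using Henstock_Kurzweil_Integration.integral_combine[OF st g_int] .
  ultimately have "f t - f s = integral {s..t} g"
    by (simp add: algebra_simps)
  also have "norm \<dots> \<le> integral {s..t} p"
  proof (rule integral_norm_bound_integral)
    show "g integrable_on {s..t}" "p integrable_on {s..t}"
      by (rule integrable_on_subinterval[OF g_int] integrable_on_subinterval[OF p[of t]];
          use st in auto)+
  qed (use st le in auto)
  also have "\<dots> = integral {0..t} p - integral {0..s} p"
    using Henstock_Kurzweil_Integration.integral_combine[OF st p] by (simp add: algebra_simps)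
  finally show ?thesis .
qed

section \<open>One-sided derivatives expressed through \<open>dt\<close>\<close>

lemma dt_eqI:
  assumes "(f has_vector_derivative f') (at t within {0..})" "0 \<le> t"
  shows "dt f t = f'"
proof -
  have "t islimpt {0..}"
    using assms(2) islimpt_subset[OF islimpt_greaterThanLessThan1[of t "t + 1"], of "{0..}"]
    by fastforce
  then show ?thesis
    unfolding dt_def using assms(1)
    by (intro vector_derivative_within) (auto simp: trivial_limit_within)
qed

lemma has_vector_derivative_dt:
  assumes "f \<in> C_space 1" "0 \<le> t"
  shows "(f has_vector_derivative dt f t) (at t within {0..})"
  using assms by (auto simp: C_space_def dt_def vector_derivative_works[symmetric])

section \<open>The resolvent and the Yosida approximation\<close>

context abstract_framework
begin

interpretation \<iota>: bounded_linear \<iota> by (rule embedding(1))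
interpretation Astar: bounded_linear Astar by (rule bounded_linear_Astar)
interpretation G: bounded_linear G by (rule bounded_linear_G)
interpretation B: bounded_linear B by (rule bounded_linear_B)

text \<open>Translates the unbounded operator into \<open>Astar\<close> on the kernel of
  \<open>B\<close>, the form in which the later arguments use it.\<close>

lemma op_A_embedding: "op_A \<iota> Astar (\<iota> v) = Astar v"
  by (simp add: op_A_def inv_f_f[OF embedding(2)])

lemma embedding_eq_0_iff: "\<iota> v = 0 \<longleftrightarrow> v = 0"
  using embedding(2) by (metis injD \<iota>.zero)

lemma inner_Astar_self: "B v = 0 \<Longrightarrow> inner (Astar v) (\<iota> v) = 0"
  using skew by (auto simp: dom_A_def op_A_embedding)

text \<open>Polarisation of \<open>inner_Astar_self\<close>.\<close>

lemma inner_Astar_skew: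
  assumes "B u = 0" "B v = 0"
  shows "inner (Astar u) (\<iota> v) = - inner (\<iota> u) (Astar v)"
proof -
  have "inner (Astar (u + v)) (\<iota> (u + v)) = 0"
    using assms by (intro inner_Astar_self) (simp add: B.add)
  then show ?thesis
    using assms[THEN inner_Astar_self]
    by (simp add: \<iota>.add Astar.add inner_add_left inner_add_right inner_commute)
qed

text \<open>Test with \<open>\<iota> v\<close>: the \<open>Astar\<close> term vanishes for every
  real \<open>\<nu>\<close>. This gives both uniqueness for the resolvent equation and the
  contraction property of its solution operator.\<close>

lemma norm_embedding_le_resolvent_equation:
  assumes "B v = 0"
  shows "norm (\<iota> v) \<le> norm (\<iota> v - \<nu> *\<^sub>R Astar v)"
proof -
  have "norm (\<iota> v) * norm (\<iota> v) = inner (\<iota> v - \<nu> *\<^sub>R Astar v) (\<iota> v)"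
    using inner_Astar_self[OF assms]
    by (simp add: inner_diff_left dot_square_norm power2_eq_square)
  also have "\<dots> \<le> norm (\<iota> v - \<nu> *\<^sub>R Astar v) * norm (\<iota> v)"
    by (rule norm_cauchy_schwarz)
  finally show ?thesis
    by (cases "\<iota> v = 0") auto
qed

lemma resolvent_equation_unique:
  assumes "B u = 0" "B v = 0" "\<iota> u - \<nu> *\<^sub>R Astar u = \<iota> v - \<nu> *\<^sub>R Astar v"
  shows "u = v"
proof -
  have "norm (\<iota> (u - v)) \<le> norm (\<iota> (u - v) - \<nu> *\<^sub>R Astar (u - v))"
    using assms by (intro norm_embedding_le_resolvent_equation) (simp add: B.diff)
  also have "\<iota> (u - v) - \<nu> *\<^sub>R Astar (u - v) = 0"
    using assms(3) by (simp add: \<iota>.diff Astar.diff algebra_simps)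
  finally show ?thesis
    using embedding_eq_0_iff[of "u - v"] by simp
qed

text \<open>Multiplied by \<open>c = \<nu> / \<mu>\<close>, the equation for \<open>\<mu>\<close>
  becomes the one for \<open>\<nu>\<close> with right-hand side c h + (1 - c) \<iota> v. Its
  solution is a fixed point of a map with Lipschitz constant \<open>\<bar>1 - c\<bar>\<close>, and
  this is below 1 exactly when 0 < c < 2.\<close>

lemma resolvent_equation_solvable_step:
  assumes solv: "\<And>h. \<exists>v. B v = 0 \<and> \<iota> v - \<nu> *\<^sub>R Astar v = h"
    and \<mu>: "\<nu> < 2 * \<mu>" "0 < \<nu>"
  shows "\<exists>v. B v = 0 \<and> \<iota> v - \<mu> *\<^sub>R Astar v = h"
proof -
  define R where "R h = (SOME v. B v = 0 \<and> \<iota> v - \<nu> *\<^sub>R Astar v = h)" for h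
  have R: "B (R h) = 0" "\<iota> (R h) - \<nu> *\<^sub>R Astar (R h) = h" for h
    unfolding R_def using someI_ex[OF solv[of h]] by auto
  define c where "c = \<nu> / \<mu>"
  have c: "\<bar>1 - c\<bar> < 1" "0 < c" "\<mu> * c = \<nu>"
    using \<mu> by (auto simp: c_def abs_if field_simps)
  let ?\<Phi> = "\<lambda>x. \<iota> (R (c *\<^sub>R h + (1 - c) *\<^sub>R x))"
  have "\<exists>!x. ?\<Phi> x = x"
  proof (rule banach_fix_type)
    show "\<forall>x y. dist (?\<Phi> x) (?\<Phi> y) \<le> \<bar>1 - c\<bar> * dist x y"
    proof (intro allI)
      fix x y
      let ?u = "R (c *\<^sub>R h + (1 - c) *\<^sub>R x)" and ?v = "R (c *\<^sub>R h + (1 - c) *\<^sub>R y)"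
      have "norm (\<iota> (?u - ?v)) \<le> norm (\<iota> (?u - ?v) - \<nu> *\<^sub>R Astar (?u - ?v))"
        by (intro norm_embedding_le_resolvent_equation) (simp add: B.diff R)
      also have "\<iota> (?u - ?v) - \<nu> *\<^sub>R Astar (?u - ?v)
          = (\<iota> ?u - \<nu> *\<^sub>R Astar ?u) - (\<iota> ?v - \<nu> *\<^sub>R Astar ?v)"
        by (simp add: \<iota>.diff Astar.diff algebra_simps)
      also have "\<dots> = (1 - c) *\<^sub>R (x - y)"
        by (simp add: R algebra_simps)
      finally show "dist (?\<Phi> x) (?\<Phi> y) \<le> \<bar>1 - c\<bar> * dist x y"
        by (simp add: dist_norm \<iota>.diff)
    qed
  qed (use c in auto)
  then obtain x where x: "?\<Phi> x = x" by auto
  let ?v = "R (c *\<^sub>R h + (1 - c) *\<^sub>R x)"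
  have "\<iota> ?v - \<nu> *\<^sub>R Astar ?v = c *\<^sub>R h + (1 - c) *\<^sub>R \<iota> ?v"
    using R(2)[of "c *\<^sub>R h + (1 - c) *\<^sub>R x"] by (simp only: x)
  then have "c *\<^sub>R (\<iota> ?v - \<mu> *\<^sub>R Astar ?v) = c *\<^sub>R h"
    using c(3) by (simp add: algebra_simps)
  then show ?thesis
    using c(2) R(1) by (intro exI[of _ ?v]) simp
qed

lemma resolvent_equation_solvable:
  assumes "0 < \<nu>"
  shows "\<exists>v. B v = 0 \<and> \<iota> v - \<nu> *\<^sub>R Astar v = h"
proof -
  \<comment> \<open>The ratio 2/3 must exceed 1/2 for each step to be admissible and be below 1 for
    the powers to tend to 0. Once a power lies below \<open>\<nu>\<close>, a single step leads up to
    \<open>\<nu>\<close>, since increases are unrestricted.\<close>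
  have pow: "\<exists>v. B v = 0 \<and> \<iota> v - ((2/3)^n) *\<^sub>R Astar v = h" for n h
  proof (induction n arbitrary: h)
    case 0
    have "h \<in> (\<lambda>u. u - op_A \<iota> Astar u) ` dom_A \<iota> B"
      using onto_minus by simp
    then show ?case
      by (auto simp: dom_A_def op_A_embedding)
  next
    case (Suc n)
    show ?case
      by (rule resolvent_equation_solvable_step[OF Suc.IH]) auto
  qed
  obtain n where "(2/3::real)^n < \<nu>"
    using real_arch_pow_inv[OF assms, of "2/3"] by auto
  then show ?thesis
    using assms by (intro resolvent_equation_solvable_step[OF pow[of n]]) auto
qed

definition resolvent :: "real \<Rightarrow> 'h \<Rightarrow> 'v" where
  "resolvent \<nu> h = (THE v. B v = 0 \<and> \<iota> v - \<nu> *\<^sub>R Astar v = h)"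

text \<open>This is (I - \<nu> A)^(-1) as an operator on H; \<open>resolvent\<close> keeps the same
  solution in V, where \<open>Astar\<close> and \<open>B\<close> can be applied to it.\<close>

definition Jop :: "real \<Rightarrow> 'h \<Rightarrow> 'h" where
  "Jop \<nu> h = \<iota> (resolvent \<nu> h)"

definition yosida :: "real \<Rightarrow> 'h \<Rightarrow> 'h" where
  "yosida \<nu> h = Astar (resolvent \<nu> h)"

lemma resolvent_eqI:
  assumes "B v = 0" "\<iota> v - \<nu> *\<^sub>R Astar v = h"
  shows "resolvent \<nu> h = v"
  unfolding resolvent_def using assms resolvent_equation_unique by (intro the_equality) auto

context
  fixes \<nu> :: real
  assumes \<nu>: "0 < \<nu>"
begin

lemma B_resolvent: "B (resolvent \<nu> h) = 0"
  and Jop_minus_yosida: "Jop \<nu> h - \<nu> *\<^sub>R yosida \<nu> h = h"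
  using resolvent_equation_solvable[OF \<nu>, of h] resolvent_eqI
  by (auto simp: Jop_def yosida_def)

lemma linear_resolvent: "linear (resolvent \<nu>)"
proof (rule linearI)
  show "resolvent \<nu> (a + b) = resolvent \<nu> a + resolvent \<nu> b" for a b
    using Jop_minus_yosida[of a] Jop_minus_yosida[of b]
    by (intro resolvent_eqI)
      (simp_all add: B.add B_resolvent \<iota>.add Astar.add Jop_def yosida_def algebra_simps)
  show "resolvent \<nu> (c *\<^sub>R a) = c *\<^sub>R resolvent \<nu> a" for c a
    using arg_cong[OF Jop_minus_yosida[of a], of "scaleR c"]
    by (intro resolvent_eqI)
      (simp_all add: B.scaleR B_resolvent \<iota>.scaleR Astar.scaleR Jop_def yosida_def algebra_simps)
qed

lemma norm_Jop_le: "norm (Jop \<nu> h) \<le> norm h"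
  using norm_embedding_le_resolvent_equation[OF B_resolvent, of h \<nu>] Jop_minus_yosida[of h]
  by (simp add: Jop_def yosida_def)

lemma bounded_linear_Jop: "bounded_linear (Jop \<nu>)"
proof (rule bounded_linear_intro)
  show "norm (Jop \<nu> h) \<le> norm h * 1" for h
    using norm_Jop_le by simp
qed (simp_all add: Jop_def linear_add[OF linear_resolvent] linear_scale[OF linear_resolvent]
    \<iota>.add \<iota>.scaleR)

text \<open>The resolvent equation expresses A (I - \<nu> A)^(-1) through \<open>Jop\<close> alone,
  which is why it is bounded on H.\<close>

lemma yosida_eq: "yosida \<nu> h = (1 / \<nu>) *\<^sub>R (Jop \<nu> h - h)"
proof -
  have "Jop \<nu> h - h = \<nu> *\<^sub>R yosida \<nu> h"
    using Jop_minus_yosida[of h] by (simp add: algebra_simps)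
  then show ?thesis using \<nu> by simp
qed

lemma norm_yosida_le: "norm (yosida \<nu> h) \<le> 2 / \<nu> * norm h"
proof -
  have "norm (Jop \<nu> h - h) \<le> 2 * norm h"
    using norm_triangle_ineq4[of "Jop \<nu> h" h] norm_Jop_le[of h] by simp
  then show ?thesis
    using \<nu> by (simp add: yosida_eq divide_simps)
qed

lemma bounded_linear_yosida: "bounded_linear (yosida \<nu>)"
  unfolding yosida_eq[abs_def]
  by (intro bounded_linear_scaleR_right[THEN bounded_linear_compose] bounded_linear_sub
      bounded_linear_Jop bounded_linear_ident)

text \<open>Decompose \<open>h\<close> by \<open>Jop_minus_yosida\<close>: the \<open>Jop\<close>
  part is orthogonal to \<open>yosida \<nu> h\<close> by skew-symmetry, and the rest contributes
  -\<nu> times a square.\<close>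

lemma inner_yosida_le: "inner (yosida \<nu> h) h \<le> 0"
proof -
  have "inner (yosida \<nu> h) (Jop \<nu> h - \<nu> *\<^sub>R yosida \<nu> h) = - \<nu> * inner (yosida \<nu> h) (yosida \<nu> h)"
    using inner_Astar_self[OF B_resolvent, of h]
    by (simp add: Jop_def yosida_def inner_diff_right)
  then show ?thesis
    using \<nu> by (simp add: Jop_minus_yosida)
qed

lemma Jop_Astar:
  assumes "B u = 0"
  shows "Jop \<nu> (Astar u) = yosida \<nu> (\<iota> u)"
proof -
  \<comment> \<open>\<open>Astar u\<close> need not lie in the domain, so its resolvent is guessed:
    by \<open>yosida_eq\<close>, \<open>Astar ?v\<close> is the image under \<open>\<iota>\<close>
    of \<open>?x\<close>, which lies in the kernel of \<open>B\<close>.\<close>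
  let ?v = "resolvent \<nu> (\<iota> u)" and ?x = "(1 / \<nu>) *\<^sub>R (resolvent \<nu> (\<iota> u) - u)"
  have x: "\<iota> ?x = Astar ?v"
    using yosida_eq[of "\<iota> u"] by (simp add: yosida_def Jop_def \<iota>.scaleR \<iota>.diff)
  have "resolvent \<nu> (Astar u) = ?x"
  proof (rule resolvent_eqI)
    show "B ?x = 0"
      using assms by (simp add: B.scaleR B.diff B_resolvent)
    show "\<iota> ?x - \<nu> *\<^sub>R Astar ?x = Astar u"
      using \<nu> unfolding x by (simp add: Astar.scaleR Astar.diff)
  qed
  then show ?thesis
    using x by (simp add: Jop_def yosida_def)
qed

end

text \<open>Apply \<open>Jop \<nu>\<close> to the equation of \<open>resolvent \<kappa> h\<close>
  and move it past \<open>Astar\<close> by \<open>Jop_Astar\<close>; the outcome is the resolvent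
  equation for \<open>\<kappa>\<close> with datum \<open>Jop \<nu> h\<close>.\<close>

lemma Jop_commute:
  assumes "0 < \<nu>" "0 < \<kappa>"
  shows "Jop \<nu> (Jop \<kappa> h) = Jop \<kappa> (Jop \<nu> h)"
proof -
  let ?u = "resolvent \<kappa> h"
  let ?v = "resolvent \<nu> (\<iota> ?u)"
  have u: "B ?u = 0" using B_resolvent[OF assms(2)] .
  interpret J: bounded_linear "Jop \<nu>" by (rule bounded_linear_Jop[OF assms(1)])
  have "Jop \<nu> h = Jop \<nu> (\<iota> ?u - \<kappa> *\<^sub>R Astar ?u)"
    using Jop_minus_yosida[OF assms(2), of h] by (simp add: Jop_def yosida_def)
  also have "\<dots> = \<iota> ?v - \<kappa> *\<^sub>R Astar ?v"
    by (simp add: J.diff J.scaleR Jop_Astar[OF assms(1) u]) (simp add: Jop_def yosida_def)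
  finally have "resolvent \<kappa> (Jop \<nu> h) = ?v"
    by (intro resolvent_eqI B_resolvent[OF assms(1)]) simp
  then show ?thesis
    by (simp add: Jop_def)
qed

lemma Jop_yosida:
  assumes "0 < \<nu>" "0 < \<kappa>"
  shows "Jop \<kappa> (yosida \<nu> h) = yosida \<nu> (Jop \<kappa> h)"
proof -
  interpret J: bounded_linear "Jop \<kappa>" by (rule bounded_linear_Jop[OF assms(2)])
  show ?thesis
    by (simp add: yosida_eq[OF assms(1)] J.scaleR J.diff Jop_commute[OF assms])
qed

text \<open>The vector equals \<open>Jop \<nu> (yosida \<kappa> h)\<close>, a contraction applied to
  something bounded in terms of \<open>\<kappa>\<close>. Unlike \<open>norm_yosida_le\<close>, the
  bound stays uniform as \<open>\<nu>\<close> tends to 0.\<close>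

lemma norm_yosida_Jop_le:
  assumes "0 < \<nu>" "0 < \<kappa>"
  shows "norm (yosida \<nu> (Jop \<kappa> h)) \<le> 2 / \<kappa> * norm h"
proof -
  have "yosida \<nu> (Jop \<kappa> h) = Jop \<nu> (yosida \<kappa> h)"
    using Jop_Astar[OF assms(1) B_resolvent[OF assms(2)]] by (simp add: Jop_def yosida_def)
  then show ?thesis
    using norm_Jop_le[OF assms(1)] norm_yosida_le[OF assms(2)] order_trans by metis
qed

text \<open>Split \<open>a - b\<close> into the difference of the \<open>Jop\<close> values,
  orthogonal to \<open>?y\<close> by skew-symmetry, and \<open>- ?w\<close>, which is of order \<nu>
  + \<mu>. Two different Yosida operators are thus jointly dissipative up to a small error.\<close>

lemma inner_yosida_diff_le:
  assumes "0 < \<nu>" "0 < \<mu>" and M: "norm (yosida \<nu> a) \<le> M" "norm (yosida \<mu> b) \<le> M"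
  shows "inner (yosida \<nu> a - yosida \<mu> b) (a - b) \<le> 2 * M\<^sup>2 * (\<nu> + \<mu>)"
proof -
  let ?y = "yosida \<nu> a - yosida \<mu> b" and ?w = "\<nu> *\<^sub>R yosida \<nu> a - \<mu> *\<^sub>R yosida \<mu> b"
  have "0 \<le> M" using M(1) norm_ge_zero order_trans by blast
  have "inner ?y (Jop \<nu> a - Jop \<mu> b) = 0"
    using inner_Astar_self[of "resolvent \<nu> a - resolvent \<mu> b"] assms
    by (simp add: B.diff B_resolvent Astar.diff \<iota>.diff yosida_def Jop_def)
  then have "inner ?y ((Jop \<nu> a - Jop \<mu> b) - ?w) = inner (- ?y) ?w"
    unfolding inner_diff_right[of ?y "Jop \<nu> a - Jop \<mu> b"] by (simp del: minus_diff_eq)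
  moreover have "(Jop \<nu> a - Jop \<mu> b) - ?w = a - b"
    using Jop_minus_yosida[OF assms(1), of a] Jop_minus_yosida[OF assms(2), of b]
    by (simp add: algebra_simps)
  ultimately have "inner ?y (a - b) = inner (- ?y) ?w"
    by (rule subst[where P = "\<lambda>d. inner ?y d = inner (- ?y) ?w", rotated])
  also have "\<dots> \<le> norm ?y * norm ?w"
    using norm_cauchy_schwarz[of "- ?y" ?w] by (simp del: minus_diff_eq)
  also have "\<dots> \<le> (2 * M) * ((\<nu> + \<mu>) * M)"
  proof (rule mult_mono)
    show "norm ?y \<le> 2 * M"
      using norm_triangle_ineq4[of "yosida \<nu> a" "yosida \<mu> b"] M by simp
    have "norm ?w \<le> \<nu> * norm (yosida \<nu> a) + \<mu> * norm (yosida \<mu> b)"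
      using norm_triangle_ineq4[of "\<nu> *\<^sub>R yosida \<nu> a" "\<mu> *\<^sub>R yosida \<mu> b"] assms by simp
    also have "\<dots> \<le> \<nu> * M + \<mu> * M"
      using assms by (intro add_mono mult_left_mono) auto
    finally show "norm ?w \<le> (\<nu> + \<mu>) * M"
      by (simp add: algebra_simps)
  qed (use \<open>0 \<le> M\<close> in auto)
  finally show ?thesis
    by (simp add: power2_eq_square algebra_simps)
qed

text \<open>For \<open>a\<close> and \<open>b\<close> as defined below the claim amounts to |a|^2
  \<le> (a, b). Skew-symmetry gives \<mu> |a|^2 + \<nu> |b|^2 = (\<nu> + \<mu>) (a, b). Estimating
  (a, b) by the mean of the two squares yields |a| \<le> |b|, and inserting this into the identity
  yields the claim.\<close>

lemma norm_Jop_diff_le: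
  assumes "0 < \<nu>" "\<nu> \<le> \<mu>"
  shows "(norm (Jop \<nu> x - Jop \<mu> x))\<^sup>2 \<le> (norm (Jop \<mu> x - x))\<^sup>2 - (norm (Jop \<nu> x - x))\<^sup>2"
proof (cases "\<nu> = \<mu>")
  case False
  then have \<mu>: "0 < \<mu>" "0 < \<mu> - \<nu>" using assms by simp_all
  define a b where "a = Jop \<nu> x - x" and "b = Jop \<mu> x - x"
  have ab: "\<mu> *\<^sub>R a - \<nu> *\<^sub>R b = (\<nu> * \<mu>) *\<^sub>R (yosida \<nu> x - yosida \<mu> x)"
    using assms(1) \<mu> by (simp add: a_def b_def yosida_eq scaleR_diff_right)
  have "inner (yosida \<nu> x - yosida \<mu> x) (Jop \<nu> x - Jop \<mu> x) = 0"
    using inner_Astar_self[of "resolvent \<nu> x - resolvent \<mu> x"] assms(1) \<mu>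
    by (simp add: B.diff B_resolvent Astar.diff \<iota>.diff yosida_def Jop_def)
  moreover have "Jop \<nu> x - Jop \<mu> x = a - b"
    by (simp add: a_def b_def)
  ultimately have "inner (\<mu> *\<^sub>R a - \<nu> *\<^sub>R b) (a - b) = 0"
    unfolding ab by simp
  then have *: "\<mu> * inner a a + \<nu> * inner b b = (\<nu> + \<mu>) * inner a b"
    by (simp add: inner_diff_left inner_diff_right inner_commute algebra_simps)
  have "0 \<le> inner (a - b) (a - b)" by simp
  then have "2 * inner a b \<le> inner a a + inner b b"
    by (simp add: inner_diff_left inner_diff_right inner_commute)
  then have "(\<nu> + \<mu>) * (2 * inner a b) \<le> (\<nu> + \<mu>) * (inner a a + inner b b)"
    using assms \<mu> by (intro mult_left_mono) auto
  then have "(\<mu> - \<nu>) * inner a a \<le> (\<mu> - \<nu>) * inner b b"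
    using * by (simp add: algebra_simps)
  then have "\<nu> * inner a a \<le> \<nu> * inner b b"
    using \<mu> assms by simp
  then have "(\<nu> + \<mu>) * inner a a \<le> (\<nu> + \<mu>) * inner a b"
    using * by (simp add: algebra_simps)
  then have "inner a a \<le> inner a b"
    using assms \<mu> by simp
  then have "inner (a - b) (a - b) \<le> inner b b - inner a a"
    by (simp add: inner_diff_left inner_diff_right inner_commute)
  then show ?thesis
    unfolding power2_norm_eq_inner by (simp add: a_def b_def)
qed simp

text \<open>This is the density of the domain of A, obtained without orthogonal projections: since their norms
  are monotone, the differences \<open>Jop \<nu> x - x\<close> converge as \<open>\<nu>\<close> tends to 0; the limit is orthogonal to
  the domain, hence 0 because I - A is onto.\<close>

lemma Jop_tendsto: "(\<lambda>m. Jop (1 / Suc m) x) \<longlonglongrightarrow> x"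
proof -
  define r where "r m = 1 / real (Suc m)" for m
  define a where "a m = Jop (r m) x - x" for m
  have r: "0 < r m" for m by (simp add: r_def)
  have r_mono: "r n \<le> r m" if "m \<le> n" for m n
    using that by (simp add: r_def frac_le)
  have step: "(norm (a n - a m))\<^sup>2 \<le> (norm (a m))\<^sup>2 - (norm (a n))\<^sup>2" if "m \<le> n" for m n
    using norm_Jop_diff_le[OF r r_mono[OF that], of x] by (simp add: a_def)
  have "decseq (\<lambda>m. (norm (a m))\<^sup>2)"
    unfolding decseq_def
  proof (intro allI impI)
    show "(norm (a n))\<^sup>2 \<le> (norm (a m))\<^sup>2" if "m \<le> n" for m n
      using step[OF that] zero_le_power2[of "norm (a n - a m)"] by linarith
  qed
  then have "convergent (\<lambda>m. (norm (a m))\<^sup>2)"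
    using decseq_convergent[of _ 0] by (metis convergentI zero_le_power2)
  then have C: "Cauchy (\<lambda>m. (norm (a m))\<^sup>2)" by (rule convergent_Cauchy)
  have "Cauchy a"
  proof (rule CauchyI)
    fix e :: real assume e: "0 < e"
    obtain N where N: "\<And>m n. N \<le> m \<Longrightarrow> N \<le> n \<Longrightarrow> \<bar>(norm (a m))\<^sup>2 - (norm (a n))\<^sup>2\<bar> < e\<^sup>2"
      using CauchyD[OF C, of "e\<^sup>2"] e by auto
    have *: "norm (a n - a m) < e" if "N \<le> m" "m \<le> n" for m n
    proof -
      have "(norm (a n - a m))\<^sup>2 < e\<^sup>2"
        using step[OF that(2)] N[of m n] that by fastforce
      then show ?thesis using e by (simp add: power2_less_imp_less)
    qed
    show "\<exists>M. \<forall>m\<ge>M. \<forall>n\<ge>M. norm (a m - a n) < e"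
      using * by (metis norm_minus_commute nle_le)
  qed
  then obtain p where p: "a \<longlonglongrightarrow> p"
    using Cauchy_convergent convergent_def by blast
  \<comment> \<open>Since \<open>a m\<close> is \<open>r m\<close> times a Yosida value,
    skew-symmetry moves A onto the fixed \<open>v\<close> and leaves a bounded quantity times
    \<open>r m\<close>.\<close>
  have ortho: "inner p (\<iota> v) = 0" if v: "B v = 0" for v
  proof (rule LIMSEQ_unique)
    show "(\<lambda>m. inner (a m) (\<iota> v)) \<longlonglongrightarrow> inner p (\<iota> v)"
      using p by (intro tendsto_inner tendsto_const)
    have "norm (inner (a m) (\<iota> v)) \<le> norm x * norm (Astar v) * inverse (real (Suc m))" for m
    proof -
      have "a m = r m *\<^sub>R yosida (r m) x"
        using Jop_minus_yosida[OF r, of m x] by (simp add: a_def algebra_simps)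
      then have "inner (a m) (\<iota> v) = - r m * inner (Jop (r m) x) (Astar v)"
        using inner_Astar_skew[OF B_resolvent[OF r] v] by (simp add: yosida_def Jop_def)
      also have "norm \<dots> \<le> r m * (norm (Jop (r m) x) * norm (Astar v))"
        using r[of m] Cauchy_Schwarz_ineq2[of "Jop (r m) x" "Astar v"]
        by (simp add: abs_mult mult_left_mono)
      also have "\<dots> \<le> r m * (norm x * norm (Astar v))"
        using r[of m] norm_Jop_le[OF r] by (intro mult_left_mono mult_right_mono) auto
      finally show ?thesis by (simp add: r_def divide_inverse mult_ac)
    qed
    moreover have "(\<lambda>m. norm x * norm (Astar v) * inverse (real (Suc m))) \<longlonglongrightarrow> 0"
      by (rule tendsto_mult_right_zero[OF LIMSEQ_inverse_real_of_nat])
    ultimately show "(\<lambda>m. inner (a m) (\<iota> v)) \<longlonglongrightarrow> 0"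
      by (rule Lim_null_comparison[OF always_eventually, OF allI])
  qed
  obtain v where v: "B v = 0" "\<iota> v - 1 *\<^sub>R Astar v = p"
    using resolvent_equation_solvable[of 1 p] by auto
  have "inner p (\<iota> v) = inner (\<iota> v) (\<iota> v)"
    using inner_Astar_self[OF v(1)] by (simp add: v(2)[symmetric] inner_diff_left)
  then have "v = 0"
    using ortho[OF v(1)] embedding_eq_0_iff by simp
  then have "p = 0"
    using v(2) by simp
  then have "(\<lambda>m. Jop (r m) x - x) \<longlonglongrightarrow> 0"
    using p unfolding a_def by simp
  then show ?thesis
    by (simp add: LIM_zero_iff r_def)
qed

section \<open>The Cauchy problem for the skew-symmetric operator\<close>

lemma norm_le_graph_norm: obtains C where "0 < C" "\<And>u. norm u \<le> C * (norm (\<iota> u) + norm (Astar u))"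
proof -
  obtain c where "0 < c" "\<And>u. c * norm u \<le> norm (\<iota> u) + norm (Astar u)"
    using graph_norm by blast
  then show thesis
    by (intro that[of "1 / c"]) (simp_all add: divide_simps mult.commute)
qed

text \<open>\<open>P\<close> majorises the increments of \<open>f\<close>, and \<open>E m\<close>
  those of its smoothing error; these real functions stand in for the derivative of
  \<open>f\<close>. \<open>E_lim\<close> is the form in which the density of the domain is
  used.\<close>

lemma cauchy_problem:
  assumes f: "continuous_on {0..} f" "f 0 = 0"
    and P: "continuous_on {0..} P" "P 0 = 0"
    and incr: "\<And>s t. 0 \<le> s \<Longrightarrow> s \<le> t \<Longrightarrow> norm (f t - f s) \<le> P t - P s"
    and E: "\<And>m. continuous_on {0..} (E m)" "\<And>m. E m 0 = 0"
    and incr_E: "\<And>m s t. 0 \<le> s \<Longrightarrow> s \<le> t \<Longrightarrow>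
      norm ((f t - Jop (1 / Suc m) (f t)) - (f s - Jop (1 / Suc m) (f s))) \<le> E m t - E m s"
    and E_lim: "\<And>t. 0 \<le> t \<Longrightarrow> (\<lambda>m. E m t) \<longlonglongrightarrow> 0"
  obtains v w where "continuous_on {0..} v" "continuous_on {0..} w" "v 0 = 0"
    "\<And>t. 0 \<le> t \<Longrightarrow> ((\<lambda>s. \<iota> (v s)) has_vector_derivative w t) (at t within {0..})"
    "\<And>t. 0 \<le> t \<Longrightarrow> w t = Astar (v t) + f t"
    "\<And>t. 0 \<le> t \<Longrightarrow> B (v t) = 0"
    "\<And>t. 0 \<le> t \<Longrightarrow> norm (w t) \<le> P t"
proof -
  define r where "r m = 1 / real (Suc m)" for m
  have r: "0 < r m" for m by (simp add: r_def)
  have r_lim: "r \<longlonglongrightarrow> 0"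
    using LIMSEQ_inverse_real_of_nat by (simp add: r_def [abs_def] divide_inverse)
  have J: "bounded_linear (Jop (r m))" and Y: "bounded_linear (yosida (r m))" for m
    using bounded_linear_Jop[OF r] bounded_linear_yosida[OF r] by auto
  note J_simps = J[THEN bounded_linear.linear, THEN linear_diff]
    J[THEN bounded_linear.linear, THEN linear_add]
  note Y_simps = Y[THEN bounded_linear.linear, THEN linear_diff]
    Y[THEN bounded_linear.linear, THEN linear_add]
  have "\<forall>n. \<exists>z. z 0 = 0 \<and> (\<forall>t\<ge>0. (z has_vector_derivative yosida (r n) (z t) + f t) (at t within {0..}))"
    using bounded_linear_cauchy_problem[OF Y f(1)] by metis
  then obtain z where z0: "\<And>n. z n 0 = 0"
    and z: "\<And>n t. 0 \<le> t \<Longrightarrow> (z n has_vector_derivative yosida (r n) (z n t) + f t) (at t within {0..})"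
    by metis
  define y where "y n t = yosida (r n) (z n t) + f t" for n t
  have zy: "(z n has_vector_derivative y n t) (at t within {0..})" if "0 \<le> t" for n t
    using z[OF that] by (simp add: y_def)
  have z_cont: "continuous_on {0..} (z n)" for n
    using zy by (rule has_vector_derivative_half_line_imp_continuous_on)
  have y_cont: "continuous_on {0..} (y n)" for n
    unfolding y_def [abs_def] using z_cont f(1)
    by (intro continuous_on_add bounded_linear.continuous_on[OF Y])
  have P_nonneg: "0 \<le> P t" if "0 \<le> t" for t
    using order_trans[OF norm_ge_zero incr[of 0 t]] that P(2) by simp
  have P_mono: "P s \<le> P t" if "0 \<le> s" "s \<le> t" for s t
    using incr[OF that] norm_ge_zero[of "f t - f s"] by linarith
  have E_mono: "E m s \<le> E m t" if "0 \<le> s" "s \<le> t" for s t m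
    using order_trans[OF norm_ge_zero incr_E[OF that]] by simp
  have y_bound: "norm (y n t) \<le> P t" if "0 \<le> t" for n t
  proof (rule derivative_estimate[OF zy z0 _ _ f(2) incr P that])
    show "inner (y n s - f s) (z n s) \<le> 0" for s
      by (simp add: y_def inner_yosida_le[OF r])
    show "inner ((y n s - f s) - (y n t - f t)) (z n s - z n t) \<le> 0" for s t
      using inner_yosida_le[OF r, of n "z n s - z n t"] by (simp add: y_def Y_simps)
  qed
  \<comment> \<open>As 1 - \<open>Jop (r m)\<close> commutes with \<open>yosida (r n)\<close>, the
    smoothing error of \<open>z n\<close> solves the approximate problem with the smoothing error of
    \<open>f\<close> as forcing. The bound does not depend on \<open>n\<close>.\<close>
  have y_J: "norm (y n t - Jop (r m) (y n t)) \<le> E m t" if "0 \<le> t" for m n t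
  proof (rule derivative_estimate[where f = "\<lambda>s. f s - Jop (r m) (f s)" and P = "E m"
        and z = "\<lambda>s. z n s - Jop (r m) (z n s)" and z' = "\<lambda>s. y n s - Jop (r m) (y n s)"])
    have eq: "(y n s - Jop (r m) (y n s)) - (f s - Jop (r m) (f s))
        = yosida (r n) (z n s - Jop (r m) (z n s))" for s
      by (simp add: y_def J_simps Y_simps Jop_yosida[OF r r])
    show "((\<lambda>s. z n s - Jop (r m) (z n s)) has_vector_derivative y n s - Jop (r m) (y n s))
        (at s within {0..})" if "0 \<le> s" for s
      by (intro has_vector_derivative_diff bounded_linear.has_vector_derivative[OF J] zy that)
    show "inner ((y n s - Jop (r m) (y n s)) - (f s - Jop (r m) (f s))) (z n s - Jop (r m) (z n s)) \<le> 0"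
      for s
      unfolding eq by (rule inner_yosida_le[OF r])
    show "inner (((y n s - Jop (r m) (y n s)) - (f s - Jop (r m) (f s)))
          - ((y n t - Jop (r m) (y n t)) - (f t - Jop (r m) (f t))))
        ((z n s - Jop (r m) (z n s)) - (z n t - Jop (r m) (z n t))) \<le> 0" for s t
      unfolding eq Y_simps(1)[symmetric] by (rule inner_yosida_le[OF r])
    show "norm ((f t - Jop (r m) (f t)) - (f s - Jop (r m) (f s))) \<le> E m t - E m s"
      if "0 \<le> s" "s \<le> t" for s t
      using incr_E[OF that] by (simp add: r_def)
  qed (use that z0 f(2) E linear_0[OF J[THEN bounded_linear.linear]] in auto)
  define Q where "Q t = integral {0..t} (\<lambda>s. (P s)\<^sup>2)" for t
  have P2_cont: "continuous_on {0..} (\<lambda>s. (P s)\<^sup>2)"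
    using P(1) by (intro continuous_intros)
  have Q: "(Q has_real_derivative (P t)\<^sup>2) (at t within {0..})" if "0 \<le> t" for t
    unfolding Q_def using integral_has_real_derivative_half_line[OF P2_cont that] .
  have Q_mono: "Q s \<le> Q t" if "0 \<le> s" "s \<le> t" for s t
    unfolding Q_def using that
    by (intro integral_subset_le integrable_continuous_real continuous_on_subset[OF P2_cont]) auto
  \<comment> \<open>In the difference \<open>f\<close> cancels, so it can be differentiated in time:
    its derivative is the difference of two Yosida operators at smoothed vectors.
    \<open>inner_yosida_diff_le\<close> with M = (2 / r m) P(s) applies; the constant 4 is its 2
    times the 2 from differentiating the squared norm.\<close>
  have Jy_diff: "(norm (Jop (r m) (y n t) - Jop (r m) (y k t)))\<^sup>2
      \<le> 4 * (2 / r m)\<^sup>2 * (r n + r k) * Q t" if "0 \<le> t" for m n k t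
  proof -
    define d where "d s = Jop (r m) (y n s) - Jop (r m) (y k s)" for s
    define d' where "d' s = yosida (r n) (Jop (r m) (y n s)) - yosida (r k) (Jop (r m) (y k s))" for s
    have d_eq: "d = (\<lambda>s. Jop (r m) (yosida (r n) (z n s)) - Jop (r m) (yosida (r k) (z k s)))"
      by (simp add: d_def y_def J_simps fun_eq_iff)
    have d: "(d has_vector_derivative d' s) (at s within {0..})" if "0 \<le> s" for s
      unfolding d_eq d'_def Jop_yosida[OF r r, symmetric]
      by (intro has_vector_derivative_diff bounded_linear.has_vector_derivative[OF J]
          bounded_linear.has_vector_derivative[OF Y] zy that)
    have "inner (d t) (d t) - inner (d 0) (d 0)
        \<le> 4 * (2 / r m)\<^sup>2 * (r n + r k) * Q t - 4 * (2 / r m)\<^sup>2 * (r n + r k) * Q 0"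
    proof (rule increment_le_of_derivative_le[OF has_real_derivative_norm_square[OF d] _ _ that])
      fix s :: real assume s: "0 \<le> s"
      show "((\<lambda>s. 4 * (2 / r m)\<^sup>2 * (r n + r k) * Q s) has_real_derivative
          4 * (2 / r m)\<^sup>2 * (r n + r k) * (P s)\<^sup>2) (at s within {0..})"
        by (intro DERIV_cmult Q s)
      have M: "norm (yosida (r i) (Jop (r m) (y i s))) \<le> 2 / r m * P s" for i
      proof (rule order_trans[OF norm_yosida_Jop_le[OF r r]])
        show "2 / r m * norm (y i s) \<le> 2 / r m * P s"
          using r[of m] by (intro mult_left_mono y_bound s) simp
      qed
      show "2 * inner (d' s) (d s) \<le> 4 * (2 / r m)\<^sup>2 * (r n + r k) * (P s)\<^sup>2"
        using inner_yosida_diff_le[OF r r M M, of n k] unfolding d_def d'_def power_mult_distrib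
        by (simp add: mult_ac)
    qed
    moreover have "d 0 = 0"
      using Y[THEN bounded_linear.linear] J[THEN bounded_linear.linear]
      by (simp add: d_eq z0 linear_0)
    moreover have "Q 0 = 0" by (simp add: Q_def)
    ultimately show ?thesis
      by (simp add: d_def power2_norm_eq_inner)
  qed
  have conv: "uniformly_convergent_on {0..T} y" for T
  proof (cases "0 \<le> T")
    case T: True
    show ?thesis
    proof (rule Cauchy_uniformly_convergent, rule uniformly_Cauchy_onI)
      fix e :: real assume e: "0 < e"
      \<comment> \<open>\<open>m\<close> is fixed first and makes the smoothing errors small for all
        \<open>n\<close>. Only then can \<open>N\<close> absorb the factor
        \<open>(2 / r m)\<^sup>2\<close>, which grows with \<open>m\<close>.\<close>
      obtain m where m: "E m T < e / 4"
        using order_tendstoD(2)[OF E_lim[OF T], of "e / 4"] e eventually_sequentially by auto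
      define C where "C = 4 * (2 / r m)\<^sup>2 * Q T"
      have "(\<lambda>n. C * r n) \<longlonglongrightarrow> 0"
        using tendsto_mult_right_zero[OF r_lim] .
      then have "\<forall>\<^sub>F n in sequentially. C * r n < (e / 4)\<^sup>2 / 2"
        using e by (intro order_tendstoD(2)) auto
      then obtain N where N: "\<And>n. N \<le> n \<Longrightarrow> C * r n < (e / 4)\<^sup>2 / 2"
        by (auto simp: eventually_sequentially)
      show "\<exists>M. \<forall>t\<in>{0..T}. \<forall>n\<ge>M. \<forall>k\<ge>M. dist (y n t) (y k t) < e"
      proof (intro exI[of _ N] ballI allI impI)
        fix t n k assume t: "t \<in> {0..T}" and nk: "N \<le> n" "N \<le> k"
        have "(norm (Jop (r m) (y n t) - Jop (r m) (y k t)))\<^sup>2 \<le> 4 * (2 / r m)\<^sup>2 * (r n + r k) * Q t"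
          using t by (intro Jy_diff) auto
        also have "\<dots> \<le> 4 * (2 / r m)\<^sup>2 * (r n + r k) * Q T"
          using t r[of n] r[of k] by (intro mult_left_mono Q_mono mult_nonneg_nonneg) auto
        also have "\<dots> = C * r n + C * r k"
          by (simp add: C_def algebra_simps)
        also have "\<dots> < (e / 4)\<^sup>2"
          using N[OF nk(1)] N[OF nk(2)] by linarith
        finally have 1: "norm (Jop (r m) (y n t) - Jop (r m) (y k t)) < e / 4"
          by (rule power2_less_imp_less) (use e in simp)
        have 2: "norm (y i t - Jop (r m) (y i t)) < e / 4" for i
          using y_J[of t i m] E_mono[of t T m] m t by auto
        have triangle: "norm (y n t - y k t) \<le> norm (y n t - Jop (r m) (y n t))
            + norm (Jop (r m) (y n t) - Jop (r m) (y k t)) + norm (y k t - Jop (r m) (y k t))"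
          using dist_triangle[of "y n t" "y k t" "Jop (r m) (y n t)"]
            dist_triangle[of "Jop (r m) (y n t)" "y k t" "Jop (r m) (y k t)"]
          by (simp add: dist_norm norm_minus_commute)
        show "dist (y n t) (y k t) < e"
          using triangle 1 2[of n] 2[of k] e unfolding dist_norm by linarith
      qed
    qed
  qed simp
  obtain w where w: "continuous_on {0..} w" "\<And>t. 0 \<le> t \<Longrightarrow> (\<lambda>n. y n t) \<longlonglongrightarrow> w t"
    and z_lim: "\<And>t. 0 \<le> t \<Longrightarrow> (\<lambda>n. z n t) \<longlonglongrightarrow> integral {0..t} w"
    using uniform_limit_antiderivative[OF zy z0 y_cont conv] by blast
  define Z where "Z t = integral {0..t} w" for t
  have Z: "(Z has_vector_derivative w t) (at t within {0..})" if "0 \<le> t" for t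
    unfolding Z_def by (rule integral_has_vector_derivative_half_line[OF w(1) that])
  have Z_cont: "continuous_on {0..} Z"
    using Z by (rule has_vector_derivative_half_line_imp_continuous_on)
  \<comment> \<open>\<open>z n t\<close> need not lie in the image of V. Its resolvent does, and
    differs from it in H by \<open>r n *\<^sub>R Astar (u n t)\<close>, which tends to 0.\<close>
  define u where "u n t = resolvent (r n) (z n t)" for n t
  have Astar_lim: "(\<lambda>n. Astar (u n t)) \<longlonglongrightarrow> w t - f t" if "0 \<le> t" for t
  proof -
    have "(\<lambda>n. y n t - f t) \<longlonglongrightarrow> w t - f t"
      using w(2)[OF that] by (intro tendsto_intros)
    then show ?thesis
      by (simp add: y_def u_def yosida_def)
  qed
  have \<iota>_lim: "(\<lambda>n. \<iota> (u n t)) \<longlonglongrightarrow> Z t" if "0 \<le> t" for t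
  proof -
    have "\<iota> (u n t) = z n t + r n *\<^sub>R Astar (u n t)" for n
      using Jop_minus_yosida[OF r, of n "z n t"] by (simp add: u_def Jop_def yosida_def algebra_simps)
    moreover have "(\<lambda>n. z n t + r n *\<^sub>R Astar (u n t)) \<longlonglongrightarrow> Z t + 0 *\<^sub>R (w t - f t)"
      using z_lim[OF that] unfolding Z_def[symmetric]
      by (intro tendsto_add tendsto_scaleR r_lim Astar_lim that)
    ultimately show ?thesis by simp
  qed
  obtain C where C: "0 < C" "\<And>u. norm u \<le> C * (norm (\<iota> u) + norm (Astar u))"
    using norm_le_graph_norm by blast
  define v where "v t = lim (\<lambda>n. u n t)" for t
  \<comment> \<open>Convergence of both \<open>\<iota> (u n t)\<close> and
    \<open>Astar (u n t)\<close> is convergence in the graph norm, hence in V; completeness of V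
    plays the part of closedness of A.\<close>
  have u_lim: "(\<lambda>n. u n t) \<longlonglongrightarrow> v t" if t: "0 \<le> t" for t
  proof -
    have "Cauchy (\<lambda>n. u n t)"
    proof (rule CauchyI)
      fix e :: real assume e: "0 < e"
      obtain M where M: "\<And>m n. M \<le> m \<Longrightarrow> M \<le> n \<Longrightarrow> norm (\<iota> (u m t) - \<iota> (u n t)) < e / (2 * C)"
        using CauchyD[OF LIMSEQ_imp_Cauchy[OF \<iota>_lim[OF t]], of "e / (2 * C)"] e C(1) by auto
      obtain N where N: "\<And>m n. N \<le> m \<Longrightarrow> N \<le> n \<Longrightarrow> norm (Astar (u m t) - Astar (u n t)) < e / (2 * C)"
        using CauchyD[OF LIMSEQ_imp_Cauchy[OF Astar_lim[OF t]], of "e / (2 * C)"] e C(1) by auto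
      show "\<exists>M. \<forall>m\<ge>M. \<forall>n\<ge>M. norm (u m t - u n t) < e"
      proof (intro exI[of _ "max M N"] allI impI)
        fix m n assume "max M N \<le> m" "max M N \<le> n"
        then have "norm (\<iota> (u m t - u n t)) + norm (Astar (u m t - u n t)) < e / C"
          using M[of m n] N[of m n] by (simp add: \<iota>.diff Astar.diff)
        then have "C * (norm (\<iota> (u m t - u n t)) + norm (Astar (u m t - u n t))) < e"
          using C(1) by (simp add: pos_less_divide_eq mult.commute)
        then show "norm (u m t - u n t) < e"
          using C(2)[of "u m t - u n t"] by linarith
      qed
    qed
    then show ?thesis
      unfolding v_def by (simp add: Cauchy_convergent_iff convergent_LIMSEQ_iff)
  qed
  have \<iota>_v: "\<iota> (v t) = Z t" and Astar_v: "Astar (v t) = w t - f t" and B_v: "B (v t) = 0"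
    if t: "0 \<le> t" for t
  proof -
    show "\<iota> (v t) = Z t"
      using LIMSEQ_unique[OF \<iota>.tendsto[OF u_lim[OF t]] \<iota>_lim[OF t]] .
    show "Astar (v t) = w t - f t"
      using LIMSEQ_unique[OF Astar.tendsto[OF u_lim[OF t]] Astar_lim[OF t]] .
    have "(\<lambda>n. B (u n t)) \<longlonglongrightarrow> 0"
      by (simp add: u_def B_resolvent[OF r])
    then show "B (v t) = 0"
      using LIMSEQ_unique[OF B.tendsto[OF u_lim[OF t]]] by blast
  qed
  show thesis
  proof (rule that[of v w])
    \<comment> \<open>Again by the graph norm: \<open>\<iota> (v t) = Z t\<close> and
      \<open>Astar (v t) = w t - f t\<close> are continuous in H.\<close>
    show "continuous_on {0..} v"
      unfolding continuous_on_def
    proof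
      fix t :: real assume t: "t \<in> {0..}"
      have "((\<lambda>s. C * (norm (Z s - Z t) + norm ((w s - f s) - (w t - f t)))) \<longlongrightarrow>
          C * (norm (Z t - Z t) + norm ((w t - f t) - (w t - f t)))) (at t within {0..})"
        using Z_cont w(1) f(1) t unfolding continuous_on_def by (intro tendsto_intros) auto
      then have "((\<lambda>s. C * (norm (Z s - Z t) + norm ((w s - f s) - (w t - f t)))) \<longlongrightarrow> 0)
          (at t within {0..})"
        by simp
      moreover have "\<forall>\<^sub>F s in at t within {0..}.
          norm (v s - v t) \<le> C * (norm (Z s - Z t) + norm ((w s - f s) - (w t - f t)))"
        unfolding eventually_at_filter
      proof (rule always_eventually, intro allI impI)
        fix s :: real assume "s \<in> {0..}"
        then show "norm (v s - v t) \<le> C * (norm (Z s - Z t) + norm ((w s - f s) - (w t - f t)))"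
          using C(2)[of "v s - v t"] t by (simp add: \<iota>.diff Astar.diff \<iota>_v Astar_v)
      qed
      ultimately have "((\<lambda>s. v s - v t) \<longlongrightarrow> 0) (at t within {0..})"
        by (rule Lim_null_comparison[rotated])
      then show "(v \<longlongrightarrow> v t) (at t within {0..})"
        by (simp add: LIM_zero_iff)
    qed
    show "v 0 = 0"
      using \<iota>_v[of 0] embedding_eq_0_iff[of "v 0"] by (simp add: Z_def)
    show "((\<lambda>s. \<iota> (v s)) has_vector_derivative w t) (at t within {0..})" if "0 \<le> t" for t
      by (rule has_vector_derivative_transform[OF _ _ Z[OF that]]) (use that \<iota>_v in auto)
    show "norm (w t) \<le> P t" if "0 \<le> t" for t
      by (rule LIMSEQ_le_const2[OF tendsto_norm[OF w(2)[OF that]]]) (intro exI allI impI y_bound that)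
    show "w t = Astar (v t) + f t" "B (v t) = 0" if "0 \<le> t" for t
      using Astar_v[OF that] B_v[OF that] by simp_all
  qed (fact w(1))
qed

section \<open>Inhomogeneous data\<close>

definition lift :: "'m1 \<times> 'm2 \<Rightarrow> 'v" where
  "lift x = (THE U. \<iota> U = Astar U + G (fst x) \<and> B U = snd x)"

lemma lift: "\<iota> (lift x) = Astar (lift x) + G (fst x)" "B (lift x) = snd x"
  using theI'[OF lift_unique[rule_format, of "fst x" "snd x"]] by (simp_all add: lift_def)

lemma lift_eqI:
  assumes "\<iota> U = Astar U + G (fst x)" "B U = snd x"
  shows "lift x = U"
  using lift_unique assms lift by blast

lemma norm_lift_le: "norm (\<iota> (lift x)) + norm (lift x) \<le> C_lift * norm x"
  using lift_bound[rule_format, of "lift x" "fst x" "snd x"] lift by simp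

text \<open>Linearity is a consequence of uniqueness in the stationary problem.\<close>

lemma bounded_linear_lift: "bounded_linear lift"
proof (rule bounded_linear_intro)
  show "lift (x + y) = lift x + lift y" for x y
    by (rule lift_eqI) (simp_all add: \<iota>.add Astar.add G.add B.add lift)
  show "lift (c *\<^sub>R x) = c *\<^sub>R lift x" for c x
    by (rule lift_eqI) (simp_all add: \<iota>.scaleR Astar.scaleR G.scaleR B.scaleR lift scaleR_add_right)
  show "norm (lift x) \<le> norm x * C_lift" for x
    using norm_lift_le[of x] norm_ge_zero[of "\<iota> (lift x)"] unfolding mult.commute[of "norm x"]
    by linarith
qed

text \<open>\<open>E m\<close> is the primitive of the norm of the smoothing error of
  \<open>g\<close>. That integrand tends to 0 pointwise by \<open>Jop_tendsto\<close> and is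
  dominated by \<open>2 * norm (g s)\<close>, so dominated convergence for real functions
  applies.\<close>

lemma Jop_error_bound:
  fixes g f :: "real \<Rightarrow> 'h"
  assumes g: "\<And>t. 0 \<le> t \<Longrightarrow> (g has_integral (f t - f 0)) {0..t}"
    and int: "\<And>t. (\<lambda>s. norm (g s)) integrable_on {0..t}"
    and err: "\<And>m t. (\<lambda>s. norm (g s - Jop (1 / Suc m) (g s))) integrable_on {0..t}"
  obtains E :: "nat \<Rightarrow> real \<Rightarrow> real"
  where "\<And>m. continuous_on {0..} (E m)" "\<And>m. E m 0 = 0"
    "\<And>m s t. 0 \<le> s \<Longrightarrow> s \<le> t \<Longrightarrow>
      norm ((f t - f s) - Jop (1 / Suc m) (f t - f s)) \<le> E m t - E m s"
    "\<And>t. 0 \<le> t \<Longrightarrow> (\<lambda>m. E m t) \<longlonglongrightarrow> 0"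
proof
  let ?p = "\<lambda>m s. norm (g s - Jop (1 / Suc m) (g s))"
  let ?E = "\<lambda>m t. integral {0..t} (?p m)"
  have J: "bounded_linear (Jop (1 / Suc m))" for m
    by (rule bounded_linear_Jop) simp
  show "continuous_on {0..} (?E m)" for m
    by (rule continuous_on_indefinite_integral_half_line[OF err])
  show "?E m 0 = 0" for m by simp
  show "norm ((f t - f s) - Jop (1 / Suc m) (f t - f s)) \<le> ?E m t - ?E m s" if "0 \<le> s" "s \<le> t" for m s t
  proof -
    interpret J: bounded_linear "Jop (1 / Suc m)" by (rule J)
    have "norm ((f t - Jop (1 / Suc m) (f t)) - (f s - Jop (1 / Suc m) (f s))) \<le> ?E m t - ?E m s"
    proof (rule norm_increment_le_integral[OF _ err _ that])
      fix t :: real assume t: "0 \<le> t"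
      show "((\<lambda>s. g s - Jop (1 / Suc m) (g s)) has_integral
          (f t - Jop (1 / Suc m) (f t)) - (f 0 - Jop (1 / Suc m) (f 0))) {0..t}"
        using has_integral_diff[OF g[OF t] has_integral_linear[OF g[OF t] J, of m]]
        by (simp add: o_def J.diff algebra_simps del: of_nat_Suc)
    qed simp
    then show ?thesis
      by (simp add: J.diff algebra_simps del: of_nat_Suc)
  qed
  show "(\<lambda>m. ?E m t) \<longlonglongrightarrow> 0" for t
  proof -
    have "(\<lambda>m. ?E m t) \<longlonglongrightarrow> integral {0..t} (\<lambda>s. 0)"
    proof (rule dominated_convergence(2)[OF err integrable_on_mult_right[OF int, of 2]])
      show "norm (?p m s) \<le> 2 * norm (g s)" for m s
        using norm_triangle_ineq4[of "g s" "Jop (1 / Suc m) (g s)"] norm_Jop_le[of "1 / Suc m" "g s"]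
        by simp
      show "(\<lambda>m. ?p m s) \<longlonglongrightarrow> 0" for s
        using tendsto_norm[OF tendsto_diff[OF tendsto_const[of "g s"] Jop_tendsto[of "g s"]]] by simp
    qed
    then show ?thesis by simp
  qed
qed

text \<open>The difference takes values in the kernel of \<open>B\<close> and has no forcing, so the
  energy estimate holds with majorant 0; injectivity of \<open>\<iota>\<close> carries the result
  back to V.\<close>

lemma solution_unique:
  assumes "is_solution \<iota> Astar G B \<xi> chi F U" "is_solution \<iota> Astar G B \<xi> chi F U'" "0 \<le> t"
  shows "U t = U' t"
proof -
  have der: "((\<lambda>s. \<iota> (U s)) has_vector_derivative Astar (U s) + G (\<xi> s) + F s) (at s within {0..})"
    "((\<lambda>s. \<iota> (U' s)) has_vector_derivative Astar (U' s) + G (\<xi> s) + F s) (at s within {0..})"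
    if "0 \<le> s" for s
    using assms(1,2) that has_vector_derivative_dt[OF _ that, of "\<lambda>s. \<iota> (U s)"]
      has_vector_derivative_dt[OF _ that, of "\<lambda>s. \<iota> (U' s)"]
    by (simp_all add: is_solution_def)
  have "norm (\<iota> (U t) - \<iota> (U' t)) \<le> norm (\<iota> (U 0) - \<iota> (U' 0)) + (0 - 0)"
  proof (rule energy_estimate[where q = "\<lambda>_. 0" and p = "\<lambda>_. 0"])
    fix s :: real assume s: "0 \<le> s"
    show "((\<lambda>s. \<iota> (U s) - \<iota> (U' s)) has_vector_derivative Astar (U s - U' s)) (at s within {0..})"
      using has_vector_derivative_diff[OF der[OF s]] by (simp add: Astar.diff)
    show "inner (Astar (U s - U' s)) (\<iota> (U s) - \<iota> (U' s)) \<le> 0 * norm (\<iota> (U s) - \<iota> (U' s))"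
      using inner_Astar_self[of "U s - U' s"] assms(1,2) s
      by (simp add: is_solution_def B.diff \<iota>.diff)
  qed (use assms(3) in auto)
  then have "\<iota> (U t - U' t) = 0"
    using assms(1,2) by (simp add: is_solution_def \<iota>.diff)
  then show ?thesis
    by (simp add: embedding_eq_0_iff)
qed

end

theorem theorem3p1:
  fixes \<iota> :: "'v::{real_inner, banach} \<Rightarrow> 'h::{real_inner, banach}"
    and Astar :: "'v \<Rightarrow> 'h"
    and G :: "'m1::{real_inner, banach} \<Rightarrow> 'h"
    and B :: "'v \<Rightarrow> 'm2::{real_inner, banach}"
    and C_lift :: real
    and \<xi> :: "real \<Rightarrow> 'm1" and chi :: "real \<Rightarrow> 'm2" and \<Xi> :: "real \<Rightarrow> 'm1 \<times> 'm2"
    and F :: "real \<Rightarrow> 'h"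
  assumes "abstract_framework \<iota> Astar G B C_lift"
    and "F \<in> W_space 1"
    and "\<Xi> = (\<lambda>t. (\<xi> t, chi t))"
    and "\<Xi> \<in> W_space 2"
  shows "\<exists>U. is_solution \<iota> Astar G B \<xi> chi F U \<and>
             (\<forall>U'. is_solution \<iota> Astar G B \<xi> chi F U' \<longrightarrow> (\<forall>t\<ge>0. U' t = U t)) \<and>
             (\<forall>t\<ge>0. norm (\<iota> (U t)) \<le>
                C_lift * (integral {0..t} (\<lambda>\<tau>. norm (\<Xi> \<tau>))
                          + 2 * integral {0..t} (\<lambda>\<tau>. norm (dt \<Xi> \<tau>)))
                + integral {0..t} (\<lambda>\<tau>. norm (F \<tau>))) \<and>
             (\<forall>t\<ge>0. norm (dt (\<lambda>s. \<iota> (U s)) t) \<le>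
                C_lift * (integral {0..t} (\<lambda>\<tau>. norm (dt \<Xi> \<tau>))
                          + 2 * integral {0..t} (\<lambda>\<tau>. norm ((dt ^^ 2) \<Xi> \<tau>)))
                + integral {0..t} (\<lambda>\<tau>. norm (dt F \<tau>)))"
proof -
  interpret abstract_framework \<iota> Astar G B C_lift by fact
  interpret \<iota>: bounded_linear \<iota> by (rule embedding)
  interpret Astar: bounded_linear Astar by (rule bounded_linear_Astar)
  interpret B: bounded_linear B by (rule bounded_linear_B)
  interpret L: bounded_linear lift by (rule bounded_linear_lift)
  \<comment> \<open>The lift seen in H; its norm bound is the source of \<open>C_lift\<close> in the
    final estimates.\<close>
  define K where "K x = \<iota> (lift x)" for x
  interpret K: bounded_linear K
    unfolding K_def [abs_def] by (rule bounded_linear_compose[OF embedding(1) bounded_linear_lift])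
  have norm_K: "norm (K x) \<le> C_lift * norm x" for x
    using norm_lift_le[of x] norm_ge_zero[of "lift x"] unfolding K_def by linarith
  \<comment> \<open>Nonnegativity of the majorants is drawn from the lift bound itself, in place of
    a sign of \<open>C_lift\<close>.\<close>
  have norm_le: "0 \<le> C_lift * norm x" for x :: "'m1 \<times> 'm2"
    using norm_K[of x] norm_ge_zero order_trans by blast

  define \<Xi>1 \<Xi>2 where "\<Xi>1 = dt \<Xi>" and "\<Xi>2 = dt \<Xi>1"
  have F: "continuous_on {0..} F" "dt F \<in> L1_space" "F 0 = 0"
    "\<And>t. 0 \<le> t \<Longrightarrow> (dt F has_integral (F t - F 0)) {0..t}"
    using assms(2) by (auto simp: W_space_def C_space_def)
  have \<Xi>_C1: "\<Xi> \<in> C_space 1" and \<Xi>: "\<Xi> 0 = 0" "\<Xi>1 0 = 0" "\<Xi>2 \<in> L1_space"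
    "\<And>t. 0 \<le> t \<Longrightarrow> (\<Xi>2 has_integral (\<Xi>1 t - \<Xi>1 0)) {0..t}"
    using assms(4) by (auto simp: W_space_def \<Xi>1_def \<Xi>2_def numeral_2_eq_2)
  have \<Xi>_der: "(\<Xi> has_vector_derivative \<Xi>1 t) (at t within {0..})" if "0 \<le> t" for t
    unfolding \<Xi>1_def by (rule has_vector_derivative_dt[OF \<Xi>_C1 that])
  have \<Xi>_cont: "continuous_on {0..} \<Xi>"
    using \<Xi>_der by (rule has_vector_derivative_half_line_imp_continuous_on)
  have \<Xi>1_cont: "continuous_on {0..} \<Xi>1"
    using \<Xi>_C1 by (simp add: C_space_def \<Xi>1_def)
  have \<Xi>1_int: "(\<Xi>1 has_integral (\<Xi> t - \<Xi> 0)) {0..t}" if "0 \<le> t" for t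
    by (rule fundamental_theorem_of_calculus[OF that])
      (auto intro: has_vector_derivative_within_subset[OF \<Xi>_der])

  have cont_int: "p integrable_on {0..t}" if "continuous_on {0..} p" for p :: "real \<Rightarrow> real" and t
    by (rule integrable_continuous_real) (rule continuous_on_subset[OF that], auto)
  have norm_int: "(\<lambda>s. norm (F s)) integrable_on {0..t}" "(\<lambda>s. norm (\<Xi> s)) integrable_on {0..t}"
    "(\<lambda>s. norm (\<Xi>1 s)) integrable_on {0..t}" for t
    using F(1) \<Xi>_cont \<Xi>1_cont by (auto intro!: cont_int continuous_on_norm)
  have norm_int': "(\<lambda>s. norm (dt F s)) integrable_on {0..t}" "(\<lambda>s. norm (\<Xi>2 s)) integrable_on {0..t}" for t
    by (rule comp_integrable_on_L1_space[where c = 1, OF F(2)]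
        comp_integrable_on_L1_space[where c = 1, OF \<Xi>(3)]; auto intro: continuous_intros)+

  \<comment> \<open>Insert U = lift \<Xi> + v into the equation: by the stationary equation
    \<open>Astar (lift (\<Xi> t)) + G (\<xi> t)\<close> is \<open>K (\<Xi> t)\<close>, and the time
    derivative of the lifted part moves to the right as \<open>- K (\<Xi>1 t)\<close>.\<close>
  define f where "f t = F t + K (\<Xi> t) - K (\<Xi>1 t)" for t
  have f_cont: "continuous_on {0..} f"
    unfolding f_def [abs_def]
    by (intro continuous_on_add continuous_on_diff K.continuous_on F(1) \<Xi>_cont \<Xi>1_cont)
  \<comment> \<open>The vanishing initial values of \<open>F\<close>, \<open>\<Xi>\<close> and
    \<open>\<Xi>1\<close> are the compatibility condition for the reduced problem.\<close>
  have f0: "f 0 = 0"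
    by (simp add: f_def F \<Xi> K.zero)

  \<comment> \<open>One term for each of the increments of \<open>F\<close>, \<open>K \<Xi>\<close>
    and \<open>K \<Xi>1\<close>, grouped as in \<open>f_split\<close>.\<close>
  define P where "P t = integral {0..t} (\<lambda>s. norm (dt F s))
    + (integral {0..t} (\<lambda>s. C_lift * norm (\<Xi>1 s)) + integral {0..t} (\<lambda>s. C_lift * norm (\<Xi>2 s)))" for t
  have P_cont: "continuous_on {0..} P"
    unfolding P_def [abs_def]
    by (intro continuous_on_add continuous_on_indefinite_integral_half_line
        integrable_on_mult_right norm_int norm_int')
  have P0: "P 0 = 0" by (simp add: P_def)
  have K_incr: "norm (K (\<Xi> t) - K (\<Xi> s))
      \<le> integral {0..t} (\<lambda>s. C_lift * norm (\<Xi>1 s)) - integral {0..s} (\<lambda>s. C_lift * norm (\<Xi>1 s))"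
    "norm (K (\<Xi>1 t) - K (\<Xi>1 s))
      \<le> integral {0..t} (\<lambda>s. C_lift * norm (\<Xi>2 s)) - integral {0..s} (\<lambda>s. C_lift * norm (\<Xi>2 s))"
    if "0 \<le> s" "s \<le> t" for s t
  proof -
    show "norm (K (\<Xi> t) - K (\<Xi> s))
      \<le> integral {0..t} (\<lambda>s. C_lift * norm (\<Xi>1 s)) - integral {0..s} (\<lambda>s. C_lift * norm (\<Xi>1 s))"
      using has_integral_linear[OF \<Xi>1_int K.bounded_linear_axioms] that norm_K
      by (intro norm_increment_le_integral[of "\<lambda>s. K (\<Xi>1 s)"] integrable_on_mult_right norm_int)
        (auto simp: o_def K.diff)
    show "norm (K (\<Xi>1 t) - K (\<Xi>1 s))
      \<le> integral {0..t} (\<lambda>s. C_lift * norm (\<Xi>2 s)) - integral {0..s} (\<lambda>s. C_lift * norm (\<Xi>2 s))"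
      using has_integral_linear[OF \<Xi>(4) K.bounded_linear_axioms] that norm_K
      by (intro norm_increment_le_integral[of "\<lambda>s. K (\<Xi>2 s)"] integrable_on_mult_right norm_int')
        (auto simp: o_def K.diff)
  qed
  have f_split: "f t - f s = (F t - F s) + ((K (\<Xi> t) - K (\<Xi> s)) - (K (\<Xi>1 t) - K (\<Xi>1 s)))" for s t
    by (simp add: f_def)
  have P_incr: "norm (f t - f s) \<le> P t - P s" if "0 \<le> s" "s \<le> t" for s t
  proof -
    have "norm (F t - F s) \<le> integral {0..t} (\<lambda>s. norm (dt F s)) - integral {0..s} (\<lambda>s. norm (dt F s))"
      by (rule norm_increment_le_integral[OF F(4) norm_int'(1) _ that]) auto
    then show ?thesis
      using K_incr[OF that] unfolding f_split P_def
      by (intro order_trans[OF norm_triangle_ineq] order_trans[OF add_left_mono[OF norm_triangle_ineq4]])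
        linarith
  qed

  have J_bl: "bounded_linear (Jop (1 / Suc m))" for m
    by (rule bounded_linear_Jop) simp
  have J_cont: "continuous_on S (\<lambda>s. Jop (1 / Suc m) (g s))" if "continuous_on S g" for S m and g :: "'x::topological_space \<Rightarrow> 'h"
    using that by (rule bounded_linear.continuous_on[OF J_bl])
  have J_err: "norm (x - Jop (1 / Suc m) x) \<le> 2 * norm x" for x m
    using norm_triangle_ineq4[of x "Jop (1 / Suc m) x"] norm_Jop_le[of "1 / Suc m" x] by simp
  \<comment> \<open>The three parts of \<open>f\<close> are treated separately because integrability
    of their smoothing errors has different sources: membership in \<open>L1_space\<close> for
    \<open>dt F\<close> and \<open>\<Xi>2\<close>, continuity for \<open>\<Xi>1\<close>.\<close>
  obtain E1 :: "nat \<Rightarrow> real \<Rightarrow> real" where E1: "\<And>m. continuous_on {0..} (E1 m)" "\<And>m. E1 m 0 = 0"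
    "\<And>m s t. 0 \<le> s \<Longrightarrow> s \<le> t \<Longrightarrow> norm ((F t - F s) - Jop (1 / Suc m) (F t - F s)) \<le> E1 m t - E1 m s"
    "\<And>t. 0 \<le> t \<Longrightarrow> (\<lambda>m. E1 m t) \<longlonglongrightarrow> 0"
  proof (rule Jop_error_bound[OF F(4) norm_int'(1)])
    show "(\<lambda>s. norm (dt F s - Jop (1 / Suc m) (dt F s))) integrable_on {0..t}" for m t
    proof (rule comp_integrable_on_L1_space[OF F(2), where c = 2])
      show "continuous_on UNIV (\<lambda>x. norm (x - Jop (1 / Suc m) x))"
        by (intro continuous_on_norm continuous_on_diff J_cont continuous_on_id)
      show "\<bar>norm (x - Jop (1 / Suc m) x)\<bar> \<le> 2 * norm x" for x
        using J_err[of x m] by simp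
    qed
  qed blast+
  obtain E2 :: "nat \<Rightarrow> real \<Rightarrow> real" where E2: "\<And>m. continuous_on {0..} (E2 m)" "\<And>m. E2 m 0 = 0"
    "\<And>m s t. 0 \<le> s \<Longrightarrow> s \<le> t \<Longrightarrow>
      norm ((K (\<Xi> t) - K (\<Xi> s)) - Jop (1 / Suc m) (K (\<Xi> t) - K (\<Xi> s))) \<le> E2 m t - E2 m s"
    "\<And>t. 0 \<le> t \<Longrightarrow> (\<lambda>m. E2 m t) \<longlonglongrightarrow> 0"
  proof (rule Jop_error_bound[where f = "\<lambda>t. K (\<Xi> t)" and g = "\<lambda>t. K (\<Xi>1 t)"])
    show "((\<lambda>t. K (\<Xi>1 t)) has_integral K (\<Xi> t) - K (\<Xi> 0)) {0..t}" if "0 \<le> t" for t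
      using has_integral_linear[OF \<Xi>1_int[OF that] K.bounded_linear_axioms] by (simp add: o_def K.diff)
    show "(\<lambda>s. norm (K (\<Xi>1 s))) integrable_on {0..t}" for t
      by (intro cont_int continuous_on_norm K.continuous_on \<Xi>1_cont)
    show "(\<lambda>s. norm (K (\<Xi>1 s) - Jop (1 / Suc m) (K (\<Xi>1 s)))) integrable_on {0..t}" for m t
      by (intro cont_int continuous_on_norm continuous_on_diff J_cont K.continuous_on \<Xi>1_cont)
  qed blast+
  obtain E3 :: "nat \<Rightarrow> real \<Rightarrow> real" where E3: "\<And>m. continuous_on {0..} (E3 m)" "\<And>m. E3 m 0 = 0"
    "\<And>m s t. 0 \<le> s \<Longrightarrow> s \<le> t \<Longrightarrow>
      norm ((K (\<Xi>1 t) - K (\<Xi>1 s)) - Jop (1 / Suc m) (K (\<Xi>1 t) - K (\<Xi>1 s))) \<le> E3 m t - E3 m s"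
    "\<And>t. 0 \<le> t \<Longrightarrow> (\<lambda>m. E3 m t) \<longlonglongrightarrow> 0"
  proof (rule Jop_error_bound[where f = "\<lambda>t. K (\<Xi>1 t)" and g = "\<lambda>t. K (\<Xi>2 t)"])
    show "((\<lambda>t. K (\<Xi>2 t)) has_integral K (\<Xi>1 t) - K (\<Xi>1 0)) {0..t}" if "0 \<le> t" for t
      using has_integral_linear[OF \<Xi>(4)[OF that] K.bounded_linear_axioms] by (simp add: o_def K.diff)
    show "(\<lambda>s. norm (K (\<Xi>2 s))) integrable_on {0..t}" for t
      by (rule comp_integrable_on_L1_space[OF \<Xi>(3), where c = C_lift])
        (auto intro!: continuous_intros K.continuous_on norm_K)
    show "(\<lambda>s. norm (K (\<Xi>2 s) - Jop (1 / Suc m) (K (\<Xi>2 s)))) integrable_on {0..t}" for m t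
    proof (rule comp_integrable_on_L1_space[OF \<Xi>(3), where c = "2 * C_lift"])
      show "continuous_on UNIV (\<lambda>x. norm (K x - Jop (1 / Suc m) (K x)))"
        by (intro continuous_on_norm continuous_on_diff J_cont K.continuous_on continuous_on_id)
      show "\<bar>norm (K x - Jop (1 / Suc m) (K x))\<bar> \<le> 2 * C_lift * norm x" for x
        using J_err[of "K x" m] norm_K[of x] by simp
    qed
  qed blast+
  obtain v w where v: "continuous_on {0..} v" "continuous_on {0..} w" "v 0 = 0"
    and v_der: "\<And>t. 0 \<le> t \<Longrightarrow> ((\<lambda>s. \<iota> (v s)) has_vector_derivative w t) (at t within {0..})"
    and w_eq: "\<And>t. 0 \<le> t \<Longrightarrow> w t = Astar (v t) + f t"
    and B_v: "\<And>t. 0 \<le> t \<Longrightarrow> B (v t) = 0"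
    and w_le: "\<And>t. 0 \<le> t \<Longrightarrow> norm (w t) \<le> P t"
  proof (rule cauchy_problem[OF f_cont f0 P_cont P0 P_incr, where E = "\<lambda>m t. E1 m t + (E2 m t + E3 m t)"])
    show "continuous_on {0..} (\<lambda>t. E1 m t + (E2 m t + E3 m t))" for m
      by (intro continuous_on_add E1 E2 E3)
    show "E1 m 0 + (E2 m 0 + E3 m 0) = 0" for m
      by (simp add: E1 E2 E3)
    show "(\<lambda>m. E1 m t + (E2 m t + E3 m t)) \<longlonglongrightarrow> 0" if "0 \<le> t" for t
      using that by (intro tendsto_add_zero E1 E2 E3)
    show "norm ((f t - Jop (1 / Suc m) (f t)) - (f s - Jop (1 / Suc m) (f s)))
        \<le> (E1 m t + (E2 m t + E3 m t)) - (E1 m s + (E2 m s + E3 m s))"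
      if st: "0 \<le> s" "s \<le> t" for m s t
    proof -
      interpret J: bounded_linear "Jop (1 / Suc m)" by (rule J_bl)
      let ?D = "\<lambda>x. x - Jop (1 / Suc m) x"
      have "?D (f t) - ?D (f s) = ?D (f t - f s)"
        by (simp add: J.diff algebra_simps del: of_nat_Suc)
      also have "\<dots> = ?D (F t - F s) + (?D (K (\<Xi> t) - K (\<Xi> s)) - ?D (K (\<Xi>1 t) - K (\<Xi>1 s)))"
        unfolding f_split J.add J.diff by simp
      finally show ?thesis
        using E1(3)[OF st, of m] E2(3)[OF st, of m] E3(3)[OF st, of m]
          norm_triangle_ineq[of "?D (F t - F s)" "?D (K (\<Xi> t) - K (\<Xi> s)) - ?D (K (\<Xi>1 t) - K (\<Xi>1 s))"]
          norm_triangle_ineq4[of "?D (K (\<Xi> t) - K (\<Xi> s))" "?D (K (\<Xi>1 t) - K (\<Xi>1 s))"]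
        by (simp only:)
    qed
  qed blast+

  define U where "U t = lift (\<Xi> t) + v t" for t
  have U_der: "((\<lambda>s. \<iota> (U s)) has_vector_derivative K (\<Xi>1 t) + w t) (at t within {0..})" if "0 \<le> t" for t
    unfolding U_def \<iota>.add K_def[symmetric]
    by (intro has_vector_derivative_add K.has_vector_derivative \<Xi>_der v_der that)
  have dt_U: "dt (\<lambda>s. \<iota> (U s)) t = K (\<Xi>1 t) + w t" if "0 \<le> t" for t
    by (rule dt_eqI[OF U_der that]) (rule that)
  have sol: "is_solution \<iota> Astar G B \<xi> chi F U"
    unfolding is_solution_def
  proof (intro conjI allI impI)
    have "continuous_on {0..} (dt (\<lambda>s. \<iota> (U s)))"
    proof (rule continuous_on_cong[THEN iffD1, OF refl])
      show "K (\<Xi>1 t) + w t = dt (\<lambda>s. \<iota> (U s)) t" if "t \<in> {0..}" for t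
        using dt_U that by simp
      show "continuous_on {0..} (\<lambda>t. K (\<Xi>1 t) + w t)"
        by (intro continuous_on_add K.continuous_on \<Xi>1_cont v)
    qed
    then show "(\<lambda>t. \<iota> (U t)) \<in> C_space 1"
      using U_der by (auto simp: C_space_def intro: differentiableI_vector)
    show "U \<in> C_space 0"
      unfolding C_space_def U_def [abs_def]
      by (auto intro!: continuous_on_add L.continuous_on \<Xi>_cont v)
    fix t :: real assume t: "0 \<le> t"
    have "K (\<Xi>1 t) + w t = Astar (U t) + G (\<xi> t) + F t"
      using lift(1)[of "\<Xi> t"] by (simp add: w_eq[OF t] f_def U_def Astar.add K_def assms(3))
    then show "dt (\<lambda>s. \<iota> (U s)) t = Astar (U t) + G (\<xi> t) + F t"
      by (simp only: dt_U[OF t])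
    show "B (U t) = chi t"
      using lift(2)[of "\<Xi> t"] by (simp add: U_def B.add B_v[OF t] assms(3))
  next
    show "U 0 = 0" by (simp add: U_def \<Xi> v L.zero)
  qed
  \<comment> \<open>The integral of \<open>norm (\<Xi>1 s)\<close> occurs twice: in the energy
    estimate for \<open>v\<close>, from the term \<open>K \<Xi>1\<close> of \<open>f\<close>, and in
    the bound on \<open>K (\<Xi> t)\<close> as a primitive of \<open>K \<Xi>1\<close>.\<close>
  have bound: "norm (\<iota> (U t)) \<le> C_lift * (integral {0..t} (\<lambda>\<tau>. norm (\<Xi> \<tau>))
      + 2 * integral {0..t} (\<lambda>\<tau>. norm (\<Xi>1 \<tau>))) + integral {0..t} (\<lambda>\<tau>. norm (F \<tau>))" if t: "0 \<le> t" for t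
  proof -
    let ?q = "\<lambda>t. integral {0..t} (\<lambda>s. norm (F s) + (C_lift * norm (\<Xi> s) + C_lift * norm (\<Xi>1 s)))"
    have "norm (\<iota> (v t)) \<le> norm (\<iota> (v 0)) + (?q t - ?q 0)"
    proof (rule energy_estimate[OF v_der integral_has_real_derivative_half_line])
      show "continuous_on {0..} (\<lambda>s. norm (F s) + (C_lift * norm (\<Xi> s) + C_lift * norm (\<Xi>1 s)))"
        by (intro continuous_intros F \<Xi>_cont \<Xi>1_cont)
      fix s :: real assume s: "0 \<le> s"
      show "0 \<le> norm (F s) + (C_lift * norm (\<Xi> s) + C_lift * norm (\<Xi>1 s))"
        by (intro add_nonneg_nonneg norm_le norm_ge_zero)
      have "norm (f s) \<le> norm (F s + K (\<Xi> s)) + norm (K (\<Xi>1 s))"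
        unfolding f_def by (rule norm_triangle_ineq4)
      also have "\<dots> \<le> norm (F s) + (C_lift * norm (\<Xi> s) + C_lift * norm (\<Xi>1 s))"
        using norm_triangle_ineq[of "F s" "K (\<Xi> s)"] norm_K[of "\<Xi> s"] norm_K[of "\<Xi>1 s"] by linarith
      finally have "norm (f s) * norm (\<iota> (v s))
          \<le> (norm (F s) + (C_lift * norm (\<Xi> s) + C_lift * norm (\<Xi>1 s))) * norm (\<iota> (v s))"
        by (rule mult_right_mono) simp
      moreover have "inner (w s) (\<iota> (v s)) = inner (f s) (\<iota> (v s))"
        by (simp add: w_eq[OF s] inner_add_left inner_Astar_self[OF B_v[OF s]])
      ultimately show "inner (w s) (\<iota> (v s))
          \<le> (norm (F s) + (C_lift * norm (\<Xi> s) + C_lift * norm (\<Xi>1 s))) * norm (\<iota> (v s))"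
        using norm_cauchy_schwarz[of "f s" "\<iota> (v s)"] by linarith
    qed (use t in auto)
    also have "\<dots> = integral {0..t} (\<lambda>s. norm (F s)) + (C_lift * integral {0..t} (\<lambda>s. norm (\<Xi> s))
        + C_lift * integral {0..t} (\<lambda>s. norm (\<Xi>1 s)))"
      by (simp add: v \<iota>.zero integral_add integrable_add norm_int integrable_on_mult_right)
    finally have "norm (\<iota> (v t)) \<le> integral {0..t} (\<lambda>s. norm (F s))
        + (C_lift * integral {0..t} (\<lambda>s. norm (\<Xi> s)) + C_lift * integral {0..t} (\<lambda>s. norm (\<Xi>1 s)))" .
    moreover have "norm (K (\<Xi> t)) \<le> C_lift * integral {0..t} (\<lambda>s. norm (\<Xi>1 s))"
      using K_incr(1)[of 0 t] t by (simp add: \<Xi> K.zero)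
    moreover have "norm (\<iota> (U t)) \<le> norm (K (\<Xi> t)) + norm (\<iota> (v t))"
      unfolding U_def \<iota>.add K_def by (rule norm_triangle_ineq)
    ultimately show ?thesis
      by (simp add: algebra_simps)
  qed
  \<comment> \<open>The same doubling one order higher: \<open>P\<close> contains the integral of
    \<open>norm (\<Xi>2 s)\<close> once, and \<open>K (\<Xi>1 t)\<close> contributes it
    again.\<close>
  have bound': "norm (dt (\<lambda>s. \<iota> (U s)) t) \<le> C_lift * (integral {0..t} (\<lambda>\<tau>. norm (\<Xi>1 \<tau>))
      + 2 * integral {0..t} (\<lambda>\<tau>. norm (\<Xi>2 \<tau>))) + integral {0..t} (\<lambda>\<tau>. norm (dt F \<tau>))"
    if t: "0 \<le> t" for t
  proof -
    have "norm (K (\<Xi>1 t)) \<le> C_lift * integral {0..t} (\<lambda>s. norm (\<Xi>2 s))"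
      using K_incr(2)[of 0 t] t by (simp add: \<Xi> K.zero)
    moreover have "norm (dt (\<lambda>s. \<iota> (U s)) t) \<le> norm (K (\<Xi>1 t)) + norm (w t)"
      unfolding dt_U[OF t] by (rule norm_triangle_ineq)
    ultimately show ?thesis
      using w_le[OF t] by (simp add: P_def algebra_simps)
  qed
  have dt2: "(dt ^^ 2) \<Xi> = \<Xi>2"
    by (simp add: \<Xi>2_def \<Xi>1_def numeral_2_eq_2)
  show ?thesis
    using sol solution_unique bound bound' unfolding dt2 \<Xi>1_def[symmetric] by blast
qed

end
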